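(* Let $T\in\mathbf{T}_n^2$ and let the set $\langle T_2\rangle$ of entries of its second column be the union of connected subsequences (maximal runs of consecutive integers) $\{a_1,a_1+1,\dots,a_1+k_1\},\dots,\{a_s,\dots,a_s+k_s\}$, where $a_i>a_{i-1}+k_{i-1}+1$ for every $1<i\le s$. Then $$\mathcal{D}(T)=\{T\langle a_j+k_j\rangle\ :\ 1\le j\le s\ \text{ and }\ \pi_{1,a_j+k_j}(T)=T\{a_j+k_j\}\}.$$
   Context: A (Young) tableau with entry set $E=\{m_1<\dots<m_n\}\subset\mathbb{Z}_{>0}$ is a filling of a Young diagram with $n$ boxes by the elements of $E$, each used once, increasing along rows and down columns. It is standard if $E=\{1,\dots,n\}$. $\mathbf{T}_n^2$ is the set of standard tableaux with $n$ boxes and at most two columns, written $T=(T_1,T_2)$ with $T_i$ the $i$-th column ($T_2$ may be empty); $\langle T_i\rangle$ is the set of entries of $T_i$. Shapes: $\mathrm{sh}(T)=(\lambda_1\ge\lambda_2\ge\dots)$ is the list of column lengths. Dominance order: $\lambda\ge\mu$ iff $\sum_{m\le i}\lambda_m\ge\sum_{m\le i}\mu_m$ for all $i$ not exceeding the number of parts of either. Projections: for $1\le i<j\le n$, $\pi_{i,j}(T)$ is obtained from $T$ by removing the entries $m_1,\dots,m_{i-1},m_{j+1},\dots,m_n$ by jeu de taquin (to remove an entry, delete it, repeatedly slide into the hole the smaller of the entries immediately to its right and immediately below it, until the hole is at an outer corner, then discard the hole; the final result does not depend on the order of removals). In particular for standard $T$, $\pi_{1,x}(T)$ is the restriction of $T$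 to entries $\le x$. Order: on $\mathbf{T}_n^2$, $\le$ is the chain order: $T\le S$ iff $\mathrm{sh}(\pi_{i,j}(T))\le\mathrm{sh}(\pi_{i,j}(S))$ for all $1\le i<j\le n$ (on $\mathbf{T}_n^2$ it coincides with the order induced from the right weak order on permutations through the Robinson–Schensted correspondence, and with reverse inclusion of closures of the corresponding orbital varieties in $\mathfrak{sl}_n$). $\mathcal{D}(T)$ is the cover of $T$: the set of $S>T$ such that there is no $P$ with $T<P<S$. For $x\in\langle T_2\rangle$, $T\langle x\rangle:=(T_1+\{x\},T_2\setminus\{x\})$ is the tableau obtained by moving $x$ from the second column into its sorted place in the first column. Deletion: let $T$ be a tableau with at most two columns and let $a$ be an entry of $T$ at a corner box (no neighbours to the right or below). If $a$ is in the first column, $T\Leftarrow a$ is $T$ with that box removed. If $a$ is in the second column, $T\Leftarrow a$ is obtained by deleting $a$ from the second column and replacing by $a$ the greatest entry $b$ of the first column with $b<a$. The tableau $T\{x\}$: put $T_{(n)}=T$ and, for $i=n,n-1,\dots,1$, let $z_i$ be the maximal entry of $T_{(i)}$ and $T_{(i-1)}:=T_{(i)}\Leftarrow z_i$. For $x\in\langle T_2\rangle$ there is a unique $i$ with $x=z_i=z_{i-1}$ (equivalently $x$ is the maximal entry of $T_{(i)}$ and lies in its second column), and $T\{x\}:=T_{(i)}$. *)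

theory Defs
  imports Main
begin

text \<open>
  A tableau with at most two columns is the pair \<open>(T\<^sub>1, T\<^sub>2)\<close> of its columns, each listed from top to
  bottom; \<open>T\<^sub>2\<close> may be empty.
\<close>

type_synonym tableau = "nat list \<times> nat list"

definition entries :: "tableau \<Rightarrow> nat set" where
  "entries T = set (fst T) \<union> set (snd T)"

definition boxes :: "tableau \<Rightarrow> nat" where
  "boxes T = length (fst T) + length (snd T)"

definition is_tableau :: "tableau \<Rightarrow> bool" where
  "is_tableau T \<longleftrightarrow>
     length (snd T) \<le> length (fst T) \<and>
     sorted_wrt (<) (fst T) \<and> sorted_wrt (<) (snd T) \<and>
     (\<forall>i < length (snd T). fst T ! i < snd T ! i) \<and>
     set (fst T) \<inter> set (snd T) = {} \<and>
     0 \<notin> entries T"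

definition std_tableaux :: "nat \<Rightarrow> tableau set" where
  "std_tableaux n = {T. is_tableau T \<and> entries T = {1..n}}"

definition shape :: "tableau \<Rightarrow> nat list" where
  "shape T = filter (\<lambda>l. l \<noteq> 0) [length (fst T), length (snd T)]"

definition dominated_by :: "nat list \<Rightarrow> nat list \<Rightarrow> bool" where
  "dominated_by \<mu> \<nu> \<longleftrightarrow>
     (\<forall>i. 1 \<le> i \<and> i \<le> min (length \<nu>) (length \<mu>) \<longrightarrow>
        sum_list (take i \<mu>) \<le> sum_list (take i \<nu>))"

text \<open>
  Sliding a hole that sits in the first column: \<open>bs\<close> are the entries of the first column strictly
  below the hole, \<open>rs\<close> the entries of the second column from the row of the hole downwards. The
  result consists of the two columns from the row of the hole downwards, the hole being discarded.
  Once the hole is in the second column, it can only move down to the bottom of that column, so the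
  entries below it just move up by one row.
\<close>

fun slide :: "nat list \<Rightarrow> nat list \<Rightarrow> nat list \<times> nat list" where
  "slide bs [] = (bs, [])"
| "slide [] (r # rs) = ([r], rs)"
| "slide (b # bs) (r # rs) =
     (if r < b then (r # b # bs, rs)
      else (let (us, vs) = slide bs rs in (b # us, r # vs)))"

definition jdt_remove :: "nat \<Rightarrow> tableau \<Rightarrow> tableau" where
  "jdt_remove a T =
     (if a \<in> set (fst T) then
        (let h = length (takeWhile (\<lambda>y. y \<noteq> a) (fst T));
             (us, vs) = slide (drop (Suc h) (fst T)) (drop h (snd T))
         in (take h (fst T) @ us, take h (snd T) @ vs))
      else (fst T, remove1 a (snd T)))"

text \<open>
  The projection \<open>\<pi>\<^sub>i\<^sub>,\<^sub>j\<close>. The entries are removed in increasing order; the order is irrelevant.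
\<close>

definition proj :: "nat \<Rightarrow> nat \<Rightarrow> tableau \<Rightarrow> tableau" where
  "proj i j T =
     (let ms = sorted_list_of_set (entries T)
      in fold jdt_remove (take (i - 1) ms @ drop j ms) T)"

definition chain_le :: "nat \<Rightarrow> tableau \<Rightarrow> tableau \<Rightarrow> bool" where
  "chain_le n T S \<longleftrightarrow>
     (\<forall>i j. 1 \<le> i \<and> i < j \<and> j \<le> n \<longrightarrow>
        dominated_by (shape (proj i j T)) (shape (proj i j S)))"

definition chain_less :: "nat \<Rightarrow> tableau \<Rightarrow> tableau \<Rightarrow> bool" where
  "chain_less n T S \<longleftrightarrow> chain_le n T S \<and> T \<noteq> S"

definition cover :: "nat \<Rightarrow> tableau \<Rightarrow> tableau set" where
  "cover n T =
     {S \<in> std_tableaux n. chain_less n T S \<and>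
        \<not> (\<exists>P \<in> std_tableaux n. chain_less n T P \<and> chain_less n P S)}"

text \<open>\<open>T\<langle>x\<rangle>\<close>; only meaningful for an entry \<open>x\<close> of the second column.\<close>

definition move_left :: "tableau \<Rightarrow> nat \<Rightarrow> tableau" where
  "move_left T x = (insort x (fst T), remove1 x (snd T))"

text \<open>\<open>T \<Leftarrow> a\<close>; only meaningful for an entry \<open>a\<close> at a corner box.\<close>

definition delete_corner :: "tableau \<Rightarrow> nat \<Rightarrow> tableau" where
  "delete_corner T a =
     (if a \<in> set (fst T) then (remove1 a (fst T), snd T)
      else (let b = Max {y \<in> set (fst T). y < a}
            in (map (\<lambda>y. if y = b then a else y) (fst T), remove1 a (snd T))))"

text \<open>\<open>stage T i\<close> is \<open>T\<^sub>(\<^sub>i\<^sub>)\<close>, the tableau with \<open>i\<close> boxes left, and \<open>stage_max T i\<close> is \<open>z\<^sub>i\<close>.\<close>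

definition stage :: "tableau \<Rightarrow> nat \<Rightarrow> tableau" where
  "stage T i = ((\<lambda>U. delete_corner U (Max (entries U))) ^^ (boxes T - i)) T"

definition stage_max :: "tableau \<Rightarrow> nat \<Rightarrow> nat" where
  "stage_max T i = Max (entries (stage T i))"

text \<open>
  \<open>T{x}\<close>, for an entry \<open>x\<close> of the second column. The guard \<open>1 < i\<close> is there because
  \<open>z\<^sub>i\<^sub>-\<^sub>1\<close> is only defined for \<open>i > 1\<close>, as \<open>T\<^sub>(\<^sub>0\<^sub>)\<close> is empty.
\<close>

definition brace :: "tableau \<Rightarrow> nat \<Rightarrow> tableau" where
  "brace T x =
     stage T (THE i. 1 < i \<and> i \<le> boxes T \<and> stage_max T i = x \<and> stage_max T (i - 1) = x)"

end

theory Submission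
  imports Defs
begin

text \<open>
  Read a standard two-column tableau as a lattice path going up at the entries of the first column and
  down at those of the second; matching every down step with the up step it cancels gives a noncrossing
  set of arcs with no unmatched point under an arc. The length of the second column of
  \<open>\<pi>\<^sub>i\<^sub>,\<^sub>j(T)\<close> is the number of arcs of \<open>T\<close> inside \<open>[i, j]\<close>, and these counts determine the arcs in such a
  way that \<open>T \<le> S\<close> iff every arc of \<open>S\<close> is an arc of \<open>T\<close>. Since points under an arc are matched, the
  arcs of such an \<open>S\<close> form a subset closed under passing to inner arcs, so the covers of \<open>T\<close> arise by
  deleting one outermost arc \<open>(y, x)\<close>, which gives \<open>T\<langle>x\<rangle>\<close>. Finally, \<open>x\<close> closes an outermost
  arc iff no entry \<open>\<le> x\<close> is lost when the entries \<open>> x\<close> are deleted as in \<open>T{x}\<close>, that is, iff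
  \<open>\<pi>\<^sub>1\<^sub>,\<^sub>x(T) = T{x}\<close>; such an \<open>x\<close> ends a run, as \<open>x + 1\<close> is not a down step.
\<close>

section \<open>Lattice paths and noncrossing arcs\<close>

text \<open>The sum stops before \<open>p\<close>, so this is the level just before step
  \<open>p\<close>. Every point outside \<open>B\<close> is an up step, including 0 and the points
  beyond the tableau.\<close>

definition height :: "nat set \<Rightarrow> nat \<Rightarrow> int" where
  "height B p = (\<Sum>y<p. if y \<in> B then -1 else 1)"

text \<open>The usual matching of parentheses: \<open>Suc a\<close> is the first point after
  \<open>b\<close> where the path is back at its level before \<open>b\<close>.\<close>

definition arcs :: "nat set \<Rightarrow> (nat \<times> nat) set" where
  "arcs B = {(b, a). b < a \<and> height B (Suc a) = height B b \<and>
     (\<forall>p. b < p \<and> p \<le> a \<longrightarrow> height B b < height B p)}"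

definition arc_count :: "nat set \<Rightarrow> nat \<Rightarrow> nat \<Rightarrow> nat" where
  "arc_count B i j = card {(b, a) \<in> arcs B. i \<le> b \<and> a \<le> j}"

text \<open>For a closer \<open>x\<close> of a path that never goes below 0 this means that no arc
  encloses \<open>x\<close>: an enclosing arc would end strictly below the level just after
  \<open>x\<close>.\<close>

definition outer :: "nat set \<Rightarrow> nat \<Rightarrow> bool" where
  "outer B x \<longleftrightarrow> (\<forall>p > x. height B (Suc x) \<le> height B p)"

lemma height_Suc: "height B (Suc p) = height B p + (if p \<in> B then -1 else 1)"
  by (simp add: height_def)

lemma height_diff:
  assumes "p \<le> q"
  shows "height B q = height B p + int (q - p) - 2 * int (card (B \<inter> {p..<q}))"
  using assms
proof (induction q rule: dec_induct)
  case base
  then show ?case by simp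
next
  case (step q)
  have "{p..<Suc q} = insert q {p..<q}" using step by auto
  then have "card (B \<inter> {p..<Suc q}) = card (B \<inter> {p..<q}) + (if q \<in> B then 1 else 0)"
    by simp
  then show ?case using step by (auto simp: height_Suc)
qed

lemma height_remove:
  "x \<in> B \<Longrightarrow> height (B - {x}) p = height B p + (if x < p then 2 else 0)"
  by (induction p) (auto simp: height_Suc less_Suc_eq, auto simp: height_def)

lemma arcs_mem:
  assumes "(b, a) \<in> arcs B"
  shows "a \<in> B" "b \<notin> B"
proof -
  have "b < a" "height B (Suc a) = height B b" "height B b < height B a" "height B b < height B (Suc b)"
    using assms by (auto simp: arcs_def)
  then show "a \<in> B" "b \<notin> B" by (auto simp: height_Suc split: if_splits)
qed

lemma arcs_less: "(b, a) \<in> arcs B \<Longrightarrow> b < a"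
  by (simp add: arcs_def)

lemma arcs_unique_closer:
  assumes "(b, a) \<in> arcs B" "(b, c) \<in> arcs B"
  shows "a = c"
proof (rule ccontr)
  have "\<not> Suc a \<le> c" if "(b, a) \<in> arcs B" "(b, c) \<in> arcs B" for a c
  proof
    assume "Suc a \<le> c"
    moreover have "b < Suc a" using arcs_less[OF that(1)] by simp
    ultimately have "height B b < height B (Suc a)" using that unfolding arcs_def by blast
    then show False using that by (simp add: arcs_def)
  qed
  moreover assume "a \<noteq> c"
  ultimately show False using assms by (meson Suc_leI linorder_neqE_nat)
qed

lemma arcs_unique_opener:
  assumes "(b, a) \<in> arcs B" "(c, a) \<in> arcs B"
  shows "b = c"
  using assms unfolding arcs_def by (cases b c rule: linorder_cases) auto

lemma inj_on_snd_arcs: "R \<subseteq> arcs B \<Longrightarrow> inj_on snd R"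
  unfolding inj_on_def by (metis arcs_unique_opener prod.collapse subsetD)

lemma inj_on_fst_arcs: "R \<subseteq> arcs B \<Longrightarrow> inj_on fst R"
  unfolding inj_on_def by (metis arcs_unique_closer prod.collapse subsetD)

text \<open>The opener is the last point up to \<open>a\<close> whose level is at most the level
  after \<open>a\<close>. The next point is higher and steps have size one, so the two levels
  agree.\<close>

lemma ex_opener:
  assumes "a \<in> B" "i \<le> a" "height B i \<le> height B (Suc a)"
  shows "\<exists>b \<ge> i. (b, a) \<in> arcs B"
proof -
  let ?P = "\<lambda>b. b \<le> a \<and> height B b \<le> height B (Suc a)"
  define b where "b = (GREATEST b. ?P b)"
  have P: "?P b"
    unfolding b_def by (rule GreatestI_nat[of ?P i a]) (use assms in auto)
  have up: "c \<le> b" if "?P c" for c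
    unfolding b_def by (rule Greatest_le_nat[of ?P c a]) (use that in auto)
  have "i \<le> b" using up assms by blast
  have "b \<noteq> a" using P assms(1) by (auto simp: height_Suc)
  with P have ba: "b < a" by simp
  have above: "height B (Suc a) < height B p" if "b < p" "p \<le> a" for p
    using up[of p] that by linarith
  have "height B (Suc a) < height B (Suc b)" using above[of "Suc b"] ba by simp
  then have "height B b = height B (Suc a)" using P by (auto simp: height_Suc[of B b] split: if_splits)
  then show ?thesis using \<open>i \<le> b\<close> ba above by (auto simp: arcs_def)
qed

text \<open>Mirror image of \<open>ex_opener\<close>: the closer is the first step after which the
  level is at most the one before \<open>b\<close>.\<close>

lemma ex_closer:
  assumes "b \<notin> B" "b \<le> q" "height B (Suc q) \<le> height B b"
  shows "\<exists>a \<le> q. (b, a) \<in> arcs B"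
proof -
  let ?P = "\<lambda>a. b \<le> a \<and> height B (Suc a) \<le> height B b"
  define a where "a = (LEAST a. ?P a)"
  have P: "?P a" unfolding a_def by (rule LeastI[of ?P q]) (use assms in auto)
  have "a \<le> q" unfolding a_def by (rule Least_le) (use assms in auto)
  have low: "height B b < height B (Suc p)" if "b \<le> p" "p < a" for p
    using not_less_Least[of p ?P] that by (auto simp: a_def)
  have "b \<noteq> a" using P assms(1) by (auto simp: height_Suc)
  with P have "b < a" by simp
  have above: "height B b < height B p" if "b < p" "p \<le> a" for p
    using low[of "p - 1"] that by simp
  have "height B b < height B a" using above \<open>b < a\<close> by simp
  then have "height B (Suc a) = height B b" using P by (auto simp: height_Suc split: if_splits)
  then show ?thesis using \<open>a \<le> q\<close> \<open>b < a\<close> above by (auto simp: arcs_def)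
qed

text \<open>Turning the down step \<open>x\<close> into an up step raises all later levels by 2,
  which arcs on one side of \<open>x\<close> do not notice. Since the old path stays at or above its
  level after \<open>x\<close>, the only arc with \<open>b <= x <= a\<close> in either path is
  \<open>(y, x)\<close> in the old one.\<close>

lemma arcs_remove:
  assumes yx: "(y, x) \<in> arcs B" and out: "outer B x"
  shows "arcs (B - {x}) = arcs B - {(y, x)}"
proof -
  have xB: "x \<in> B" using yx arcs_mem by blast
  have out': "height B (Suc x) \<le> height B (Suc p)" if "x \<le> p" for p
    using out that by (auto simp: outer_def)
  have "(b, a) \<in> arcs (B - {x}) \<longleftrightarrow> (b, a) \<in> arcs B \<and> (b, a) \<noteq> (y, x)" for b a
  proof (cases "a < x \<or> x < b")
    case True
    then consider "a < x" | "x < b" by blast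
    then show ?thesis
    proof cases
      case 1
      then have "height (B - {x}) p = height B p" if "p \<le> Suc a" for p
        using that by (simp add: height_remove[OF xB])
      then show ?thesis using 1 unfolding arcs_def by force
    next
      case 2
      then have "height (B - {x}) p = height B p + 2" if "b \<le> p" for p
        using that by (simp add: height_remove[OF xB])
      then show ?thesis using 2 unfolding arcs_def by force
    qed
  next
    case False
    then have ax: "b \<le> x" "x \<le> a" by auto
    have "(b, a) \<notin> arcs (B - {x})"
    proof
      assume r: "(b, a) \<in> arcs (B - {x})"
      then have "a \<noteq> x" "b < a" using arcs_mem arcs_less by blast+
      then have ba: "x < a" using ax by simp
      then have "height (B - {x}) b < height (B - {x}) (Suc x)"
      proof -
        have "b < Suc x \<and> Suc x \<le> a" using ba ax by simp
        then show ?thesis using r unfolding arcs_def by blast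
      qed
      moreover have "height (B - {x}) (Suc a) = height (B - {x}) b" using r by (simp add: arcs_def)
      ultimately show False using out'[of a] ax by (auto simp: height_remove[OF xB] split: if_splits)
    qed
    moreover have "(b, a) = (y, x)" if r: "(b, a) \<in> arcs B"
    proof (cases "a = x")
      case True
      then show ?thesis using r yx arcs_unique_opener by blast
    next
      case False
      then have "b < Suc x \<and> Suc x \<le> a" using ax by simp
      then have "height B b < height B (Suc x)" "height B (Suc a) = height B b"
        using r unfolding arcs_def by blast+
      then show ?thesis using out'[of a] ax by simp
    qed
    ultimately show ?thesis by blast
  qed
  then show ?thesis by auto
qed

section \<open>Arc counts of intervals\<close>

lemma finite_arcs_upto: "finite {(b, a) \<in> arcs B. i \<le> b \<and> a \<le> j}"
  by (rule finite_subset[of _ "{..j} \<times> {..j}"]) (auto dest: arcs_less)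

text \<open>Each arc inside the interval uses one point of \<open>B\<close> and one outside it, and
  distinct arcs share none. In case of equality every down step of the interval has its opener
  there, which keeps the path from dropping below its starting level.\<close>

lemma two_arc_count_le: "2 * arc_count B i j \<le> Suc j - i"
  and two_arc_count_eqD: "2 * arc_count B i j = Suc j - i \<Longrightarrow> i \<le> j \<Longrightarrow>
    height B (Suc j) = height B i \<and> (\<forall>p. i \<le> p \<and> p \<le> Suc j \<longrightarrow> height B i \<le> height B p)"
proof -
  let ?R = "{(b, a) \<in> arcs B. i \<le> b \<and> a \<le> j}"
  have R: "?R \<subseteq> arcs B" by auto
  have c1: "card (snd ` ?R) = arc_count B i j"
    unfolding arc_count_def by (rule card_image[OF inj_on_snd_arcs[OF R]])
  have c2: "card (fst ` ?R) = arc_count B i j"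
    unfolding arc_count_def by (rule card_image[OF inj_on_fst_arcs[OF R]])
  have s1: "snd ` ?R \<subseteq> B \<inter> {i..<Suc j}" and s2: "fst ` ?R \<subseteq> {i..<Suc j} - B"
    using arcs_mem arcs_less by fastforce+
  have l1: "arc_count B i j \<le> card (B \<inter> {i..<Suc j})"
    using card_mono[OF _ s1] c1 by simp
  have l2: "arc_count B i j \<le> card ({i..<Suc j} - B)"
    using card_mono[OF _ s2] c2 by simp
  have tot: "card (B \<inter> {i..<Suc j}) + card ({i..<Suc j} - B) = Suc j - i"
    using card_Int_Diff[of "{i..<Suc j}" B] by (simp add: Int_commute)
  show "2 * arc_count B i j \<le> Suc j - i" using l1 l2 tot by linarith
  assume eq: "2 * arc_count B i j = Suc j - i" and "i \<le> j"
  have c3: "card (B \<inter> {i..<Suc j}) = arc_count B i j" using l1 l2 tot eq by linarith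
  have all: "snd ` ?R = B \<inter> {i..<Suc j}"
    by (rule card_subset_eq[OF _ s1]) (use c1 c3 in auto)
  have "height B (Suc j) = height B i"
    using height_diff[of i "Suc j" B] \<open>i \<le> j\<close> c3 eq by auto
  moreover have "height B i \<le> height B p" if "i \<le> p" "p \<le> Suc j" for p
    using that
  proof (induction p rule: less_induct)
    case (less p)
    show ?case
    proof (rule ccontr)
      assume low: "\<not> height B i \<le> height B p"
      then have "p \<noteq> i" by auto
      \<comment> \<open>The drop is made by the down step \<open>a\<close>. Its opener lies in the
        interval at the level of \<open>p\<close>, against the induction hypothesis.\<close>
      then obtain a where a: "p = Suc a" "i \<le> a" using less.prems by (cases p) auto
      have "height B i \<le> height B a" using less a by auto
      then have "a \<in> B" using low a by (auto simp: height_Suc split: if_splits)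
      then have "a \<in> snd ` ?R" using all a less.prems by auto
      then obtain b where b: "(b, a) \<in> arcs B" "i \<le> b" by auto
      have "height B i \<le> height B b" using less.IH[of b] b a less.prems arcs_less[OF b(1)] by auto
      then show False using low b a by (auto simp: arcs_def)
    qed
  qed
  ultimately show "height B (Suc j) = height B i \<and> (\<forall>p. i \<le> p \<and> p \<le> Suc j \<longrightarrow> height B i \<le> height B p)"
    by blast
qed

text \<open>Staying above the starting level gives every down step an opener inside the interval,
  and equal end levels make the down steps half of the points.\<close>

lemma two_arc_count_eqI:
  assumes "i \<le> j" "height B (Suc j) = height B i"
    and low: "\<And>p. i \<le> p \<Longrightarrow> p \<le> Suc j \<Longrightarrow> height B i \<le> height B p"
  shows "2 * arc_count B i j = Suc j - i"
proof -
  let ?R = "{(b, a) \<in> arcs B. i \<le> b \<and> a \<le> j}"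
  have "snd ` ?R = B \<inter> {i..<Suc j}"
  proof (intro equalityI subsetI)
    fix a assume a: "a \<in> B \<inter> {i..<Suc j}"
    then obtain b where "b \<ge> i" "(b, a) \<in> arcs B" using ex_opener[of a B i] low[of "Suc a"] by auto
    then have "(b, a) \<in> ?R" using a by auto
    then show "a \<in> snd ` ?R" by (rule image_eqI[rotated]) simp
  qed (use arcs_mem arcs_less in fastforce)
  moreover have "?R \<subseteq> arcs B" by auto
  ultimately have "arc_count B i j = card (B \<inter> {i..<Suc j})"
    unfolding arc_count_def by (metis (no_types, lifting) card_image inj_on_snd_arcs)
  then show ?thesis using height_diff[of i "Suc j" B] assms(1,2) by auto
qed

text \<open>
  An interval is perfectly matched by its arcs iff it contains the maximal possible number of them.
  The interval \<open>[p, q]\<close> and its interior are both perfectly matched iff \<open>(p, q)\<close> is an arc, so the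
  arcs are determined by the counts.
\<close>

lemma arcs_subset_iff:
  assumes "arcs S \<subseteq> {1..} \<times> {..n}"
  shows "arcs S \<subseteq> arcs T \<longleftrightarrow> (\<forall>i j. 1 \<le> i \<and> i < j \<and> j \<le> n \<longrightarrow> arc_count S i j \<le> arc_count T i j)"
proof
  assume "arcs S \<subseteq> arcs T"
  then show "\<forall>i j. 1 \<le> i \<and> i < j \<and> j \<le> n \<longrightarrow> arc_count S i j \<le> arc_count T i j"
    unfolding arc_count_def by (auto intro!: card_mono finite_arcs_upto)
next
  assume le: "\<forall>i j. 1 \<le> i \<and> i < j \<and> j \<le> n \<longrightarrow> arc_count S i j \<le> arc_count T i j"
  \<comment> \<open>The bound \<open>two_arc_count_le\<close> depends on the interval only, so an
    interval that is full for \<open>S\<close> is full for \<open>T\<close>.\<close>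
  have perf: "height T (Suc j) = height T i \<and> (\<forall>p. i \<le> p \<and> p \<le> Suc j \<longrightarrow> height T i \<le> height T p)"
    if "1 \<le> i" "i < j" "j \<le> n" "2 * arc_count S i j = Suc j - i" for i j
  proof (rule two_arc_count_eqD)
    have "arc_count S i j \<le> arc_count T i j" using le that by blast
    then show "2 * arc_count T i j = Suc j - i" using two_arc_count_le[of T i j] that by linarith
  qed (use that in simp)
  have "(p, q) \<in> arcs T" if pq: "(p, q) \<in> arcs S" for p q
  proof -
    have "1 \<le> p" "p < q" "q \<le> n" using arcs_less[OF pq] assms pq by auto
    have hS: "height S (Suc q) = height S p" "\<And>r. p < r \<Longrightarrow> r \<le> q \<Longrightarrow> height S p < height S r"
      using pq by (auto simp: arcs_def)
    have low: "height S p \<le> height S r" if "p \<le> r" "r \<le> Suc q" for r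
      using hS that by (cases "r = p \<or> r = Suc q") (auto simp: le_Suc_eq intro: less_imp_le)
    have T1: "height T (Suc q) = height T p" "\<And>r. p \<le> r \<Longrightarrow> r \<le> Suc q \<Longrightarrow> height T p \<le> height T r"
      using perf[of p q] two_arc_count_eqI[OF _ hS(1) low] \<open>1 \<le> p\<close> \<open>p < q\<close> \<open>q \<le> n\<close> by auto
    have p1: "height T (Suc p) = height T p + 1"
      using T1(2)[of "Suc p"] \<open>p < q\<close> by (auto simp: height_Suc split: if_splits)
    have "height T p < height T r" if r: "p < r" "r \<le> q" for r
    proof (cases "r = Suc p")
      case True
      then show ?thesis using p1 by simp
    next
      case False
      then have pq1: "Suc p < q" using r by simp
      have S1: "height S (Suc p) = height S p + 1" using arcs_mem[OF pq] by (simp add: height_Suc)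
      have Sq: "height S q = height S p + 1" using arcs_mem[OF pq] hS(1) by (simp add: height_Suc)
      \<comment> \<open>\<open>perf\<close> needs at least two points. The interior of an arc has an
        even number of points, so once nonempty it qualifies.\<close>
      have "Suc p \<noteq> q - 1"
      proof
        assume "Suc p = q - 1"
        then have "q = Suc (Suc p)" using pq1 by simp
        then show False using S1 Sq by (simp add: height_Suc split: if_splits)
      qed
      then have "Suc p < q - 1" using pq1 by simp
      moreover have "2 * arc_count S (Suc p) (q - 1) = Suc (q - 1) - Suc p"
      proof (rule two_arc_count_eqI)
        show "height S (Suc (q - 1)) = height S (Suc p)" using S1 Sq pq1 by simp
        show "height S (Suc p) \<le> height S r" if "Suc p \<le> r" "r \<le> Suc (q - 1)" for r
          using hS(2)[of r] that pq1 S1 by auto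
      qed (use pq1 in simp)
      ultimately have "height T (Suc p) \<le> height T r"
        using perf[of "Suc p" "q - 1"] \<open>q \<le> n\<close> r pq1 by auto
      then show ?thesis using p1 by simp
    qed
    then show ?thesis using T1 \<open>p < q\<close> by (auto simp: arcs_def)
  qed
  then show "arcs S \<subseteq> arcs T" by auto
qed

text \<open>On a path that never goes below 0, \<open>ex_opener\<close> applies to every down step
  with \<open>i = 0\<close>. Thus the arcs recover the second column.\<close>

lemma snd_arcs:
  assumes "\<And>p. 0 \<le> height B p"
  shows "snd ` arcs B = B"
proof (intro equalityI subsetI)
  fix a assume "a \<in> B"
  then obtain b where "(b, a) \<in> arcs B"
    using ex_opener[of a B 0] assms[of "Suc a"] by (auto simp: height_def)
  then show "a \<in> snd ` arcs B" by force
qed (use arcs_mem in auto)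

text \<open>
  The arc with the greatest closer among those missing from \<open>S\<close> is an outermost arc of \<open>T\<close>: an arc of
  \<open>T\<close> around it would be an arc of \<open>S\<close>, and every point under an arc of \<open>S\<close> is matched in \<open>S\<close>.
\<close>

lemma ex_outer_arc:
  assumes pos: "\<And>p. 0 \<le> height T p" "\<And>p. 0 \<le> height S p" and fin: "finite T"
    and less: "arcs S \<subset> arcs T"
  shows "\<exists>y x. (y, x) \<in> arcs T \<and> outer T x \<and> arcs S \<subseteq> arcs T - {(y, x)}"
proof -
  let ?D = "snd ` (arcs T - arcs S)"
  define x where "x = Max ?D"
  have fD: "finite ?D" by (rule finite_subset[OF _ fin]) (auto dest: arcs_mem)
  have "?D \<noteq> {}" using less by auto
  then have "x \<in> ?D" unfolding x_def by (rule Max_in[OF fD])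
  then obtain y where y: "(y, x) \<in> arcs T" "(y, x) \<notin> arcs S" by auto
  have maxx: "a \<le> x" if "(b, a) \<in> arcs T" "(b, a) \<notin> arcs S" for b a
    unfolding x_def by (rule Max_ge[OF fD]) (use that in force)
  have "outer T x"
  proof (rule ccontr)
    assume "\<not> outer T x"
    then obtain p0 where p0: "x < p0" "height T p0 < height T (Suc x)"
      by (auto simp: outer_def not_le)
    \<comment> \<open>\<open>p\<close> is the first point after \<open>x\<close> below the level
      after \<open>x\<close>. The down step \<open>a\<close> leading to it and its opener
      \<open>c\<close> form an arc around \<open>(y, x)\<close>.\<close>
    define p where "p = (LEAST p. x < p \<and> height T p < height T (Suc x))"
    have p: "x < p" "height T p < height T (Suc x)"
      using LeastI[of "\<lambda>p. x < p \<and> height T p < height T (Suc x)" p0] p0 by (auto simp: p_def)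
    have lowp: "height T (Suc x) \<le> height T q" if "x < q" "q < p" for q
      using not_less_Least[of q "\<lambda>p. x < p \<and> height T p < height T (Suc x)"] that
      by (auto simp: p_def)
    have "p \<noteq> Suc x" using p by auto
    then obtain a where a: "p = Suc a" "x < a" using p by (cases p) auto
    have "a \<in> T" using lowp[of a] a p by (auto simp: height_Suc split: if_splits)
    then obtain c where c: "(c, a) \<in> arcs T"
      using ex_opener[of a T 0] pos(1)[of "Suc a"] by (auto simp: height_def)
    have hc: "height T c = height T p" using c a by (auto simp: arcs_def)
    have "\<not> x < c" using lowp[of c] hc p a arcs_less[OF c] by auto
    moreover have "c \<noteq> x" using arcs_mem[OF c] arcs_mem[OF y(1)] by auto
    ultimately have cx: "c < x" by simp
    have "c \<noteq> y" using c y(1) arcs_unique_closer[of c a T x] a by auto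
    moreover have "\<not> y < c" using y(1) cx hc p(2) by (auto simp: arcs_def)
    ultimately have "c < y" by simp
    \<comment> \<open>No missing arc has a closer beyond \<open>x\<close>.\<close>
    have cS: "(c, a) \<in> arcs S" using maxx[OF c] a by auto
    then have hS: "height S (Suc a) = height S c" "\<And>q. c < q \<Longrightarrow> q \<le> a \<Longrightarrow> height S c < height S q"
      by (auto simp: arcs_def)
    show False
    \<comment> \<open>As a closer in \<open>S\<close>, \<open>x\<close> would have the opener
      \<open>y\<close>, by uniqueness in \<open>T\<close>. As an up step under \<open>(c, a)\<close>
      it would open an arc of \<open>S\<close>, hence of \<open>T\<close>, where \<open>x\<close> is
      a down step.\<close>
    proof (cases "x \<in> S")
      case True
      then obtain b where "(b, x) \<in> arcs S"
        using ex_opener[of x S 0] pos(2)[of "Suc x"] by (auto simp: height_def)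
      then show False using less y arcs_unique_opener by blast
    next
      case False
      then obtain q where "(x, q) \<in> arcs S"
        using ex_closer[of x S a] hS a cx by (auto intro: less_imp_le)
      then have "(x, q) \<in> arcs T" using less by auto
      then show False using arcs_mem y by blast
    qed
  qed
  then show ?thesis using y less by auto
qed

section \<open>Removal of entries by jeu de taquin\<close>

definition cnt :: "nat set \<Rightarrow> nat \<Rightarrow> nat" where
  "cnt A p = card {y \<in> A. y \<le> p}"

lemma cnt_insert: "finite A \<Longrightarrow> r \<notin> A \<Longrightarrow> cnt (insert r A) p = cnt A p + (if r \<le> p then 1 else 0)"
proof -
  assume "finite A" "r \<notin> A"
  moreover have "{y \<in> insert r A. y \<le> p} = (if r \<le> p then insert r {y \<in> A. y \<le> p} else {y \<in> A. y \<le> p})"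
    by auto
  ultimately show ?thesis by (simp add: cnt_def)
qed

lemma cnt_remove:
  assumes "finite A" "a \<in> A"
  shows "cnt A p = cnt (A - {a}) p + (if a \<le> p then 1 else 0)"
proof -
  have "cnt (insert a (A - {a})) p = cnt (A - {a}) p + (if a \<le> p then 1 else 0)"
    by (rule cnt_insert) (use assms in auto)
  then show ?thesis unfolding insert_Diff[OF assms(2)] .
qed

lemma cnt_le_length: "cnt (set xs) p \<le> length xs"
  unfolding cnt_def by (rule le_trans[OF card_mono card_length]) auto

lemma nth_le_iff_less_cnt:
  assumes "sorted_wrt (<) xs" "i < length xs"
  shows "xs ! i \<le> p \<longleftrightarrow> i < cnt (set xs) p"
  using assms
proof (induction xs arbitrary: i)
  case Nil
  then show ?case by simp
next
  case (Cons x xs)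
  have x: "x \<notin> set xs" "\<And>y. y \<in> set xs \<Longrightarrow> x < y" using Cons.prems(1) by auto
  have c: "cnt (set (x # xs)) p = cnt (set xs) p + (if x \<le> p then 1 else 0)"
    using x by (simp add: cnt_insert)
  have z: "cnt (set xs) p = 0" if "p < x" using x(2) that by (fastforce simp: cnt_def)
  show ?case
  proof (cases i)
    case 0
    then show ?thesis using c z by (auto simp: not_le)
  next
    case (Suc j)
    have "x < xs ! j" using x(2) Suc Cons.prems by simp
    then have "x \<le> p" if "xs ! j \<le> p" using that by simp
    then show ?thesis using Cons.IH[of j] Cons.prems Suc c z by (auto simp: not_le)
  qed
qed

lemma sorted_wrt_less_nth_mono:
  "sorted_wrt (<) (xs :: nat list) \<Longrightarrow> i \<le> j \<Longrightarrow> j < length xs \<Longrightarrow> xs ! i \<le> xs ! j"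
  by (cases "i = j") (auto intro!: less_imp_le sorted_wrt_nth_less[of "(<)"])

lemma sorted_wrt_less_distinct: "sorted_wrt (<) (xs :: nat list) \<Longrightarrow> distinct xs"
  by (simp add: strict_sorted_iff)

text \<open>If \<open>g + 1\<close> entries of the second column are at most \<open>p\<close>, so is
  the one in row \<open>g\<close> (counted from 0), and so is its left neighbour; for the converse
  take \<open>p = G ! i\<close>. From here on tableaux can be handled through the sets of their
  column entries.\<close>

lemma columns_iff_cnt:
  assumes F: "sorted_wrt (<) F" and G: "sorted_wrt (<) G" and "set F \<inter> set G = {}"
  shows "(length G \<le> length F \<and> (\<forall>i < length G. F ! i < G ! i)) \<longleftrightarrow>
    (\<forall>p. cnt (set G) p \<le> cnt (set F) p)"
proof
  assume l: "length G \<le> length F \<and> (\<forall>i < length G. F ! i < G ! i)"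
  show "\<forall>p. cnt (set G) p \<le> cnt (set F) p"
  proof
    fix p
    show "cnt (set G) p \<le> cnt (set F) p"
    proof (cases "cnt (set G) p")
      case (Suc g)
      then have "g < length G" using cnt_le_length[of G p] by simp
      then have "G ! g \<le> p" using nth_le_iff_less_cnt[OF G] Suc by simp
      then have "F ! g \<le> p" using l \<open>g < length G\<close> by fastforce
      then show ?thesis using nth_le_iff_less_cnt[OF F, of g p] l \<open>g < length G\<close> Suc by simp
    qed simp
  qed
next
  assume c: "\<forall>p. cnt (set G) p \<le> cnt (set F) p"
  have i: "i < length F \<and> F ! i < G ! i" if "i < length G" for i
  proof -
    have "i < cnt (set G) (G ! i)" using nth_le_iff_less_cnt[OF G that, of "G ! i"] by simp
    then have f: "i < cnt (set F) (G ! i)" using c by (meson less_le_trans)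
    then have "i < length F" using cnt_le_length by (meson less_le_trans)
    moreover from this have "F ! i \<le> G ! i" using nth_le_iff_less_cnt[OF F] f by simp
    moreover have "F ! i \<noteq> G ! i" using assms(3) \<open>i < length F\<close> that by (metis disjoint_iff nth_mem)
    ultimately show ?thesis by simp
  qed
  \<comment> \<open>If \<open>G\<close> were longer, the instance \<open>i = length F\<close> would
    put \<open>length F\<close> below itself.\<close>
  then have "length G \<le> length F" using i[of "length F"] by (meson less_irrefl not_le)
  then show "length G \<le> length F \<and> (\<forall>i < length G. F ! i < G ! i)" using i by blast
qed

lemma is_tableau_iff:
  "is_tableau T \<longleftrightarrow> sorted_wrt (<) (fst T) \<and> sorted_wrt (<) (snd T) \<and>
     set (fst T) \<inter> set (snd T) = {} \<and> 0 \<notin> entries T \<and>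
     (\<forall>p. cnt (set (snd T)) p \<le> cnt (set (fst T)) p)"
  using columns_iff_cnt[of "fst T" "snd T"] unfolding is_tableau_def by blast

text \<open>Unfolds the recursion: either the hole reaches the bottom of the first column, or it
  crosses in row \<open>k\<close>, counted from its start, the first row where the entry to the
  right is smaller than the one below or nothing is below.\<close>

lemma slide_cases:
  "(length rs \<le> length bs \<and> (\<forall>l < length rs. bs ! l \<le> rs ! l) \<and> slide bs rs = (bs, rs)) \<or>
   (\<exists>k < length rs. k \<le> length bs \<and> (\<forall>l < k. bs ! l \<le> rs ! l) \<and> (k < length bs \<longrightarrow> rs ! k < bs ! k) \<and>
      slide bs rs = (take k bs @ rs ! k # drop k bs, take k rs @ drop (Suc k) rs))"
proof (induction bs rs rule: slide.induct)
  case (3 b bs r rs)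
  show ?case
  proof (cases "r < b")
    case True
    then show ?thesis by (intro disjI2 exI[of _ 0]) simp
  next
    case False
    from 3[OF False] show ?thesis
    proof
      assume "length rs \<le> length bs \<and> (\<forall>l < length rs. bs ! l \<le> rs ! l) \<and> slide bs rs = (bs, rs)"
      then show ?thesis using False by (intro disjI1) (auto simp: less_Suc_eq_0_disj)
    next
      assume "\<exists>k < length rs. k \<le> length bs \<and> (\<forall>l < k. bs ! l \<le> rs ! l) \<and> (k < length bs \<longrightarrow> rs ! k < bs ! k) \<and>
        slide bs rs = (take k bs @ rs ! k # drop k bs, take k rs @ drop (Suc k) rs)"
      then obtain k where "k < length rs" "k \<le> length bs" "\<forall>l < k. bs ! l \<le> rs ! l"
        "k < length bs \<longrightarrow> rs ! k < bs ! k"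
        "slide bs rs = (take k bs @ rs ! k # drop k bs, take k rs @ drop (Suc k) rs)" by blast
      then show ?thesis using False by (intro disjI2 exI[of _ "Suc k"]) (auto simp: less_Suc_eq_0_disj)
    qed
  qed
qed auto

lemma set_take_drop_Suc:
  assumes "distinct xs" "i < length xs"
  shows "set (take i xs @ drop (Suc i) xs) = set xs - {xs ! i}"
proof -
  have "distinct (take i xs @ xs ! i # drop (Suc i) xs)" using id_take_nth_drop[OF assms(2)] assms(1) by simp
  moreover have "set xs = set (take i xs @ xs ! i # drop (Suc i) xs)"
    using id_take_nth_drop[OF assms(2)] by simp
  ultimately show ?thesis by auto
qed

text \<open>
  The entry \<open>r\<close> that a slide moves to the first column sits where the surplus of first-column
  entries first vanishes after \<open>a\<close>.
\<close>

lemma jdt_remove_first_column: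
  assumes T: "is_tableau T" and a: "a \<in> set (fst T)"
  obtains
    (stay) F where "jdt_remove a T = (F, snd T)" "sorted_wrt (<) F" "set F = set (fst T) - {a}"
      "\<And>p. a \<le> p \<Longrightarrow> cnt (set (snd T)) p < cnt (set (fst T)) p"
  | (move) r F G where "jdt_remove a T = (F, G)" "sorted_wrt (<) F" "sorted_wrt (<) G"
      "r \<in> set (snd T)" "a < r"
      "set F = insert r (set (fst T) - {a})" "set G = set (snd T) - {r}"
      "\<And>p. a \<le> p \<Longrightarrow> p < r \<Longrightarrow> cnt (set (snd T)) p < cnt (set (fst T)) p"
      "cnt (set (snd T)) r = cnt (set (fst T)) r"
proof -
  define F where "F = fst T"
  define G where "G = snd T"
  define h where "h = length (takeWhile (\<lambda>y. y \<noteq> a) F)"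
  define bs where "bs = drop (Suc h) F"
  define rs where "rs = drop h G"
  have sF: "sorted_wrt (<) F" and sG: "sorted_wrt (<) G" and len: "length G \<le> length F"
    and col: "\<And>i. i < length G \<Longrightarrow> F ! i < G ! i"
    using T by (auto simp: is_tableau_def F_def G_def)
  have h: "h < length F"
  proof (rule ccontr)
    assume "\<not> h < length F"
    then have "takeWhile (\<lambda>y. y \<noteq> a) F = F"
      using takeWhile_eq_take[of "\<lambda>y. y \<noteq> a" F] by (simp add: h_def)
    then show False using a unfolding takeWhile_eq_all_conv F_def by blast
  qed
  have Fh: "F ! h = a" using nth_length_takeWhile[of "\<lambda>y. y \<noteq> a" F] h by (simp add: h_def)
  have bsn: "bs ! l = F ! (Suc h + l)" if "Suc h + l < length F" for l
    using that by (simp add: bs_def)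
  have rsn: "rs ! l = G ! (h + l)" if "h + l < length G" for l
    using that by (simp add: rs_def)
  \<comment> \<open>With \<open>g = cnt (set G) p\<close>, the first-column entry in row
    \<open>g\<close> is at most \<open>p\<close>: down to row \<open>h\<close> because
    \<open>a <= p\<close>, further below because the comparisons of the slide bound it by the
    second-column entry in row \<open>g - 1\<close>.\<close>
  have strict: "cnt (set G) p < cnt (set F) p"
    if "a \<le> p" "cnt (set G) p \<le> h + K" "cnt (set G) p < length F"
      "\<And>l. l < K \<Longrightarrow> h + l < length G \<Longrightarrow> bs ! l \<le> rs ! l" for p K
  proof -
    let ?g = "cnt (set G) p"
    have "F ! ?g \<le> p"
    proof (cases "?g \<le> h")
      case True
      then show ?thesis using sorted_wrt_less_nth_mono[OF sF True h] Fh that(1) by simp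
    next
      case False
      define l where "l = ?g - Suc h"
      have gl: "?g = Suc h + l" using False by (simp add: l_def)
      have lG: "h + l < length G" using cnt_le_length[of G p] gl by simp
      have "F ! ?g = bs ! l" using bsn[of l] gl that(3) by simp
      also have "\<dots> \<le> rs ! l" using that(2,4) gl lG by simp
      also have "\<dots> = G ! (h + l)" using rsn lG by simp
      also have "\<dots> \<le> p" using nth_le_iff_less_cnt[OF sG lG] gl by simp
      finally show ?thesis .
    qed
    then show ?thesis using nth_le_iff_less_cnt[OF sF that(3)] by simp
  qed
  have F_split: "F = take h F @ a # bs" using id_take_nth_drop[OF h] Fh by (simp add: bs_def)
  have sF': "sorted_wrt (<) (take h F @ a # bs)" using sF F_split by simp
  have setF: "set (take h F) \<union> set bs = set F - {a}"
    using set_take_drop_Suc[OF sorted_wrt_less_distinct[OF sF] h] Fh by (simp add: bs_def)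
  have jdt: "jdt_remove a T = (take h F @ fst (slide bs rs), take h G @ snd (slide bs rs))"
    using a by (simp add: jdt_remove_def h_def F_def G_def bs_def rs_def Let_def split: prod.split)
  from slide_cases[of rs bs] show thesis
  proof (elim disjE exE conjE)
    assume l: "length rs \<le> length bs" "\<forall>l < length rs. bs ! l \<le> rs ! l" "slide bs rs = (bs, rs)"
    show thesis
    proof (rule stay)
      show "jdt_remove a T = (take h F @ bs, snd T)" using jdt l(3) by (simp add: rs_def G_def)
      show "sorted_wrt (<) (take h F @ bs)" using sF' by (auto simp: sorted_wrt_append)
      show "set (take h F @ bs) = set (fst T) - {a}" using setF by (simp add: F_def)
      show "cnt (set (snd T)) p < cnt (set (fst T)) p" if "a \<le> p" for p
        unfolding F_def[symmetric] G_def[symmetric]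
      proof (rule strict[OF that, of "length rs"])
        have "length G \<le> h + length rs" by (simp add: rs_def)
        then show "cnt (set G) p \<le> h + length rs" using cnt_le_length[of G p] by simp
        have "length G < length F" using l(1) h by (simp add: bs_def rs_def)
        then show "cnt (set G) p < length F" using cnt_le_length[of G p] by simp
      qed (use l(2) in simp)
    qed
  next
    fix k
    assume k: "k < length rs" "k \<le> length bs" "\<forall>l < k. bs ! l \<le> rs ! l" "k < length bs \<longrightarrow> rs ! k < bs ! k"
      and sl: "slide bs rs = (take k bs @ rs ! k # drop k bs, take k rs @ drop (Suc k) rs)"
    define r where "r = rs ! k"
    have hk: "h + k < length G" using k(1) by (simp add: rs_def)
    have hkF: "h + k < length F" using hk len by simp
    have rG: "r = G ! (h + k)" using rsn[OF hk] by (simp add: r_def)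
    have ar: "a < r" using col[OF hk] sorted_wrt_less_nth_mono[OF sF, of h "h + k"] hkF Fh rG by simp
    have srs: "sorted_wrt (<) rs" using sG by (simp add: rs_def sorted_wrt_drop)
    have sbs: "sorted_wrt (<) bs" using sF by (simp add: bs_def sorted_wrt_drop)
    have lowr: "y < r" if y: "y \<in> set (take k bs)" for y
    proof -
      obtain l where l: "l < k" "y = bs ! l" using y k(2) by (auto simp: in_set_conv_nth)
      then have "bs ! l \<le> rs ! l" using k(3) by simp
      also have "rs ! l < rs ! k" using sorted_wrt_nth_less[OF srs] l k(1) by simp
      finally show ?thesis using l by (simp add: r_def)
    qed
    have highr: "r < y" if y: "y \<in> set (drop k bs)" for y
    proof -
      obtain l where "l < length (drop k bs)" "y = drop k bs ! l" using y by (metis in_set_conv_nth)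
      then have l: "k + l < length bs" "y = bs ! (k + l)" by auto
      have "r < bs ! k" using k(4) l by (simp add: r_def)
      also have "\<dots> \<le> bs ! (k + l)" using sorted_wrt_less_nth_mono[OF sbs] l by simp
      finally show ?thesis using l by simp
    qed
    have G': "take h G @ take k rs @ drop (Suc k) rs = take (h + k) G @ drop (Suc (h + k)) G"
      by (simp add: rs_def take_add add.commute)
    show thesis
    proof (rule move)
      show "jdt_remove a T = (take h F @ take k bs @ r # drop k bs, take (h + k) G @ drop (Suc (h + k)) G)"
        using jdt sl G' by (simp add: r_def)
      have "sorted_wrt (<) (take k bs @ drop k bs)" using sbs by simp
      then have "sorted_wrt (<) (take k bs @ r # drop k bs)"
        using lowr highr unfolding sorted_wrt_append by auto
      moreover have "y < z" if "y \<in> set (take h F)" "z \<in> set (take k bs @ r # drop k bs)" for y z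
      proof -
        have "y < a" "\<forall>z \<in> set bs. y < z" using sF' that(1) by (auto simp: sorted_wrt_append)
        then show ?thesis using that(2) ar by (auto dest: in_set_takeD in_set_dropD)
      qed
      ultimately show "sorted_wrt (<) (take h F @ take k bs @ r # drop k bs)"
        using sF' by (auto simp: sorted_wrt_append)
      have "sorted_wrt (<) (take (h + k) G @ G ! (h + k) # drop (Suc (h + k)) G)"
        using sG id_take_nth_drop[OF hk] by simp
      then show "sorted_wrt (<) (take (h + k) G @ drop (Suc (h + k)) G)"
        by (auto simp: sorted_wrt_append)
      show "r \<in> set (snd T)" using rG hk by (simp add: G_def)
      show "a < r" by (rule ar)
      have "set (take k bs) \<union> set (drop k bs) = set bs" by (metis append_take_drop_id set_append)
      then show "set (take h F @ take k bs @ r # drop k bs) = insert r (set (fst T) - {a})"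
        using setF unfolding F_def[symmetric] by auto
      show "set (take (h + k) G @ drop (Suc (h + k)) G) = set (snd T) - {r}"
        using set_take_drop_Suc[OF sorted_wrt_less_distinct[OF sG] hk] rG by (simp add: G_def)
      show "cnt (set (snd T)) p < cnt (set (fst T)) p" if "a \<le> p" "p < r" for p
        unfolding F_def[symmetric] G_def[symmetric]
      proof (rule strict[OF that(1), of k])
        show "cnt (set G) p \<le> h + k"
          using nth_le_iff_less_cnt[OF sG hk, of p] rG that(2) by linarith
        then show "cnt (set G) p < length F" using hkF by simp
      qed (use k in simp)
      \<comment> \<open>\<open>r\<close> sits in row \<open>h + k\<close> of the second column, and
        a first-column entry in row \<open>h + k + 1\<close> exceeds \<open>r\<close> because the
        hole crossed in row \<open>h + k\<close>. So both counts are
        \<open>h + k + 1\<close>.\<close>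
      have "cnt (set G) r = Suc (h + k)"
      proof (rule antisym)
        show "Suc (h + k) \<le> cnt (set G) r" using nth_le_iff_less_cnt[OF sG hk, of r] rG by simp
        show "cnt (set G) r \<le> Suc (h + k)"
        proof (rule ccontr)
          assume n: "\<not> cnt (set G) r \<le> Suc (h + k)"
          then have l: "Suc (h + k) < length G" using cnt_le_length[of G r] by simp
          then have "G ! Suc (h + k) \<le> r" using nth_le_iff_less_cnt[OF sG l] n by simp
          then show False using sorted_wrt_nth_less[OF sG, of "h + k" "Suc (h + k)"] l rG by simp
        qed
      qed
      moreover have "cnt (set F) r = Suc (h + k)"
      proof (rule antisym)
        show "Suc (h + k) \<le> cnt (set F) r"
          using nth_le_iff_less_cnt[OF sF hkF, of r] col[OF hk] rG by simp
        show "cnt (set F) r \<le> Suc (h + k)"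
        proof (rule ccontr)
          assume n: "\<not> cnt (set F) r \<le> Suc (h + k)"
          then have l: "Suc (h + k) < length F" using cnt_le_length[of F r] by simp
          then have "F ! Suc (h + k) \<le> r" using nth_le_iff_less_cnt[OF sF l] n by simp
          moreover have "k < length bs" using l by (simp add: bs_def)
          ultimately show False using k(4) bsn[of k] l by (simp add: r_def)
        qed
      qed
      ultimately show "cnt (set (snd T)) r = cnt (set (fst T)) r" by (simp add: F_def G_def)
    qed
  qed
qed

text \<open>Removing a first-column entry \<open>a\<close> lowers the surplus of that column only
  where it was positive, and from \<open>r\<close> on the moved entry makes up for the loss. The
  last conjunct is what makes removals of large entries mere restrictions of the second
  column.\<close>

lemma jdt_remove_tableau:
  assumes T: "is_tableau T"
  shows "is_tableau (jdt_remove a T) \<and> entries (jdt_remove a T) = entries T - {a} \<and>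
    set (snd (jdt_remove a T)) \<inter> {..<a} = set (snd T) \<inter> {..<a}"
proof (cases "a \<in> set (fst T)")
  case True
  have TT: "sorted_wrt (<) (snd T)" "set (fst T) \<inter> set (snd T) = {}" "0 \<notin> entries T"
    "\<And>p. cnt (set (snd T)) p \<le> cnt (set (fst T)) p"
    using T by (auto simp: is_tableau_iff)
  from T True show ?thesis
  proof (cases rule: jdt_remove_first_column)
    case (stay F)
    have "cnt (set (snd T)) p \<le> cnt (set F) p" for p
    proof -
      have "cnt (set (fst T)) p = cnt (set F) p + (if a \<le> p then 1 else 0)"
        unfolding stay(3) using True by (intro cnt_remove) auto
      then show ?thesis using stay(4)[of p] TT(4)[of p] by (simp split: if_splits)
    qed
    then have "is_tableau (F, snd T)"
      using stay(2,3) TT by (auto simp: is_tableau_iff entries_def)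
    then show ?thesis using stay(1,3) TT(2) True by (auto simp: entries_def)
  next
    case (move r F G)
    have r: "r \<notin> set (fst T) - {a}" using move(4) TT(2) by auto
    have "cnt (set G) p \<le> cnt (set F) p" for p
    proof -
      have "cnt (set F) p = cnt (set (fst T) - {a}) p + (if r \<le> p then 1 else 0)"
        unfolding move(6) by (rule cnt_insert[OF _ r]) simp
      moreover have "cnt (set (fst T)) p = cnt (set (fst T) - {a}) p + (if a \<le> p then 1 else 0)"
        using True by (intro cnt_remove) auto
      moreover have "cnt (set (snd T)) p = cnt (set G) p + (if r \<le> p then 1 else 0)"
        unfolding move(7) using move(4) by (intro cnt_remove) auto
      ultimately show ?thesis using move(5) move(8)[of p] TT(4)[of p] by (simp split: if_splits)
    qed
    then have "is_tableau (F, G)"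
      using move(2-7) TT by (auto simp: is_tableau_iff entries_def)
    then show ?thesis using move(1,4-7) TT(2) True by (auto simp: entries_def)
  qed
next
  case False
  have TT: "sorted_wrt (<) (snd T)" "sorted_wrt (<) (fst T)" "set (fst T) \<inter> set (snd T) = {}" "0 \<notin> entries T"
    "\<And>p. cnt (set (snd T)) p \<le> cnt (set (fst T)) p"
    using T by (auto simp: is_tableau_iff)
  have s: "set (remove1 a (snd T)) = set (snd T) - {a}"
    using sorted_wrt_less_distinct[OF TT(1)] by simp
  have so: "sorted_wrt (<) (remove1 a (snd T))"
    using TT(1) by (simp add: strict_sorted_iff sorted_remove1)
  have "cnt (set (snd T) - {a}) p \<le> cnt (set (snd T)) p" for p
    unfolding cnt_def by (rule card_mono) auto
  then have "is_tableau (fst T, remove1 a (snd T))"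
    using TT so s by (auto simp: is_tableau_iff entries_def intro: le_trans)
  then show ?thesis using False s by (auto simp: jdt_remove_def entries_def)
qed

lemma fold_jdt_remove_above:
  assumes "is_tableau U" "\<And>x. x \<in> set xs \<Longrightarrow> j < x"
  shows "is_tableau (fold jdt_remove xs U) \<and> entries (fold jdt_remove xs U) = entries U - set xs \<and>
    set (snd (fold jdt_remove xs U)) \<inter> {..j} = set (snd U) \<inter> {..j}"
  using assms
proof (induction xs arbitrary: U)
  case (Cons x xs)
  have J: "is_tableau (jdt_remove x U)" "entries (jdt_remove x U) = entries U - {x}"
    "set (snd (jdt_remove x U)) \<inter> {..<x} = set (snd U) \<inter> {..<x}"
    using jdt_remove_tableau[OF Cons.prems(1)] by auto
  have "j < x" using Cons.prems by simp
  then have "set (snd (jdt_remove x U)) \<inter> {..j} = set (snd U) \<inter> {..j}" using J(3) by fastforce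
  then show ?case using Cons.IH[OF J(1)] Cons.prems(2) J(2) by auto
qed simp

section \<open>The chain order as reverse inclusion of arcs\<close>

lemma sorted_wrt_less_eqI:
  "sorted_wrt (<) (xs :: nat list) \<Longrightarrow> sorted_wrt (<) ys \<Longrightarrow> set xs = set ys \<Longrightarrow> xs = ys"
  by (metis sorted_list_of_set_unique strict_sorted_iff sorted_list_of_set.idem_if_sorted_distinct)

lemma tableau_eqI:
  assumes "is_tableau S" "is_tableau T" "entries S = entries T" "set (snd S) = set (snd T)"
  shows "S = T"
proof -
  have "set (fst S) = entries S - set (snd S)" "set (fst T) = entries T - set (snd T)"
    using assms(1,2) by (auto simp: is_tableau_def entries_def)
  then have "set (fst S) = set (fst T)" using assms by simp
  then show ?thesis
    using assms sorted_wrt_less_eqI by (auto simp: is_tableau_def prod_eq_iff)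
qed

section \<open>Paths of tableaux whose entries form an interval\<close>

lemma height_below: "B \<subseteq> {m..} \<Longrightarrow> p \<le> m \<Longrightarrow> height B p = int p"
  by (induction p) (auto simp: height_Suc, auto simp: height_def)

lemma height_eq_cnt: "height B (Suc p) = int (Suc p) - 2 * int (cnt B p)"
proof -
  have "B \<inter> {0..<Suc p} = {y \<in> B. y \<le> p}" by auto
  then show ?thesis using height_diff[of 0 "Suc p" B] by (simp add: cnt_def height_def)
qed

text \<open>The points below \<open>m\<close> contribute \<open>m\<close> up steps, and those beyond
  \<open>n\<close> another \<open>p - n\<close>, which is 0 in \<open>nat\<close> for
  \<open>p <= n\<close>.\<close>

lemma height_columns:
  assumes "A \<union> B = {m..n}" "A \<inter> B = {}" "m \<le> p" "m \<le> Suc n"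
  shows "height B (Suc p) = int m + int (cnt A p) - int (cnt B p) + int (p - n)"
proof -
  have "finite A" "finite B" using assms(1) by (metis finite_Un finite_atLeastAtMost)+
  then have "cnt A p + cnt B p = card ({y \<in> A. y \<le> p} \<union> {y \<in> B. y \<le> p})"
    unfolding cnt_def using assms(2) by (intro card_Un_disjoint[symmetric]) auto
  also have "{y \<in> A. y \<le> p} \<union> {y \<in> B. y \<le> p} = {y \<in> A \<union> B. y \<le> p}" by blast
  also have "\<dots> = {m..min p n}" unfolding assms(1) by auto
  finally show ?thesis using assms(3,4) by (auto simp: height_eq_cnt)
qed

text \<open>Such tableaux are left when the entries below \<open>m\<close> of a standard tableau are
  removed; \<open>m = Suc n\<close> is the empty one.\<close>

context
  fixes U m n
  assumes U: "is_tableau U" "entries U = {m..n}" "m \<le> Suc n"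
begin

lemma tableau_columns:
  "set (fst U) \<union> set (snd U) = {m..n}" "set (fst U) \<inter> set (snd U) = {}" "set (snd U) \<subseteq> {m..}"
  using U by (auto simp: is_tableau_def entries_def)

lemma tableau_height:
  "m \<le> p \<Longrightarrow> height (set (snd U)) (Suc p) =
    int m + int (cnt (set (fst U)) p) - int (cnt (set (snd U)) p) + int (p - n)"
  using height_columns[OF tableau_columns(1,2)] U(3) by simp

lemma tableau_height_ge: "m \<le> p \<Longrightarrow> int m \<le> height (set (snd U)) p"
proof (cases p)
  case (Suc q)
  assume "m \<le> p"
  show ?thesis
  proof (cases "m \<le> q")
    case True
    have "cnt (set (snd U)) q \<le> cnt (set (fst U)) q" using U(1) by (simp add: is_tableau_iff)
    then show ?thesis using tableau_height[OF True] Suc by simp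
  next
    case False
    then have "p = m" using \<open>m \<le> p\<close> Suc by simp
    then show ?thesis using height_below[OF tableau_columns(3), of m] by simp
  qed
qed (simp add: height_def)

lemma tableau_height_nonneg: "0 \<le> height (set (snd U)) p"
  using tableau_height_ge[of p] height_below[OF tableau_columns(3), of p] by (cases "m \<le> p") auto

text \<open>An opener below \<open>m\<close> starts at a level below \<open>m\<close>, to which the
  path never returns after \<open>m\<close>.\<close>

lemma tableau_arcs: "arcs (set (snd U)) \<subseteq> {m..} \<times> {..n}"
proof (rule subrelI)
  fix b a assume r: "(b, a) \<in> arcs (set (snd U))"
  then have a: "m \<le> a" "a \<le> n" using arcs_mem(1)[OF r] tableau_columns by auto
  show "(b, a) \<in> {m..} \<times> {..n}"
  proof (rule ccontr)
    assume "(b, a) \<notin> {m..} \<times> {..n}"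
    then have "b < m" using a by auto
    then have "height (set (snd U)) b < int m" using height_below[OF tableau_columns(3), of b] by simp
    then show False using r tableau_height_ge[of "Suc a"] a by (auto simp: arcs_def)
  qed
qed

text \<open>The least entry \<open>m\<close> is an up step from level \<open>m\<close>. The slide
  moves left the entry where the surplus first vanishes, that is, where the path first returns to
  level \<open>m\<close>: this is the closer of \<open>m\<close>. If nothing moves, \<open>m\<close>
  is unmatched.\<close>

lemma jdt_remove_least:
  assumes "m \<le> n"
  shows "arcs (set (snd (jdt_remove m U))) = {(b, a) \<in> arcs (set (snd U)). m < b}"
proof -
  let ?B = "set (snd U)"
  have hm: "height ?B m = int m" using height_below[OF tableau_columns(3), of m] by simp
  have mU: "m \<in> set (fst U)"
  proof (rule ccontr)
    assume "m \<notin> set (fst U)"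
    moreover have "m \<in> set (fst U) \<union> ?B" unfolding tableau_columns(1) using assms by simp
    ultimately have "m \<in> ?B" by blast
    then obtain i where "i < length (snd U)" "snd U ! i = m" by (auto simp: in_set_conv_nth)
    then have "fst U ! i < m" "fst U ! i \<in> set (fst U)" using U(1) by (auto simp: is_tableau_def)
    moreover from this have "fst U ! i \<in> {m..n}" unfolding tableau_columns(1)[symmetric] by blast
    ultimately show False by simp
  qed
  from U(1) mU show ?thesis
  proof (cases rule: jdt_remove_first_column)
    case (stay F)
    have "b \<noteq> m" if r: "(b, a) \<in> arcs ?B" for b a
    proof
      assume "b = m"
      then have "m \<le> a" "height ?B (Suc a) = int m" using r hm by (auto simp: arcs_def)
      then show False using tableau_height[of a] stay(4)[of a] by simp
    qed
    then show ?thesis using stay(1) tableau_arcs by fastforce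
  next
    case (move r F G)
    have rn: "r \<le> n" using move(4) tableau_columns(1) by auto
    have hr: "height ?B (Suc r) = int m" using tableau_height[of r] move(5,9) rn by simp
    have above: "int m < height ?B p" if p: "m < p" "p \<le> r" for p
    proof -
      obtain q where q: "p = Suc q" using p by (cases p) auto
      then show ?thesis using tableau_height[of q] move(8)[of q] p by simp
    qed
    have mr: "(m, r) \<in> arcs ?B" using move(5) hr hm above by (auto simp: arcs_def)
    \<comment> \<open>From \<open>m\<close> on the path never goes below level \<open>m\<close>, so
      the arc from \<open>m\<close> is outermost.\<close>
    have "outer ?B r" using hr tableau_height_ge move(5) by (auto simp: outer_def)
    then have "arcs (set G) = arcs ?B - {(m, r)}" using arcs_remove[OF mr] move(7) by simp
    moreover have "(b, a) \<in> arcs ?B \<Longrightarrow> (b, a) \<noteq> (m, r) \<Longrightarrow> m < b" for b a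
      using tableau_arcs arcs_unique_closer[OF mr, of a] by (cases "b = m") fastforce+
    ultimately show ?thesis using move(1) by auto
  qed
qed

end

lemma fold_jdt_remove_least:
  assumes "T \<in> std_tableaux n" "i \<le> n"
  shows "is_tableau (fold jdt_remove [1..<Suc i] T) \<and>
    entries (fold jdt_remove [1..<Suc i] T) = {Suc i..n} \<and>
    arcs (set (snd (fold jdt_remove [1..<Suc i] T))) = {(b, a) \<in> arcs (set (snd T)). i < b}"
  using assms(2)
proof (induction i)
  case 0
  have T: "is_tableau T" "entries T = {1..n}" using assms(1) by (auto simp: std_tableaux_def)
  then show ?case using tableau_arcs[OF T] by fastforce
next
  case (Suc i)
  define U where "U = fold jdt_remove [1..<Suc i] T"
  have U: "is_tableau U" "entries U = {Suc i..n}"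
    "arcs (set (snd U)) = {(b, a) \<in> arcs (set (snd T)). i < b}"
    using Suc by (auto simp: U_def)
  have f: "fold jdt_remove [1..<Suc (Suc i)] T = jdt_remove (Suc i) U" by (simp add: U_def)
  have "{Suc i..n} - {Suc i} = {Suc (Suc i)..n}" by auto
  then show ?case
    unfolding f using jdt_remove_tableau[OF U(1), of "Suc i"] jdt_remove_least[OF U(1,2)] U(2,3) Suc.prems
    by auto
qed

text \<open>\<open>proj\<close> removes the small entries first, which deletes the arcs opening
  before \<open>i\<close>; the large ones then only cut the second column at \<open>j\<close>. What
  remains there are the closers of the arcs inside \<open>[i, j]\<close>.\<close>

lemma proj_std:
  assumes "T \<in> std_tableaux n" "1 \<le> i" "i \<le> j" "j \<le> n"
  shows "is_tableau (proj i j T)" "entries (proj i j T) = {i..j}"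
    "length (snd (proj i j T)) = arc_count (set (snd T)) i j"
    "i = 1 \<Longrightarrow> set (snd (proj i j T)) = set (snd T) \<inter> {..j}"
proof -
  have T: "is_tableau T" "entries T = {1..n}" using assms(1) by (auto simp: std_tableaux_def)
  define U where "U = fold jdt_remove [1..<i] T"
  have U: "is_tableau U" "entries U = {i..n}"
    "arcs (set (snd U)) = {(b, a) \<in> arcs (set (snd T)). i \<le> b}"
    using fold_jdt_remove_least[OF assms(1), of "i - 1"] assms by (auto simp: U_def)
  have ms: "sorted_list_of_set {1..n} = [1..<Suc n]"
    by (metis atLeastLessThanSuc_atLeastAtMost sorted_list_of_set_range)
  have P: "proj i j T = fold jdt_remove [Suc j..<Suc n] U"
    unfolding proj_def T(2) ms Let_def using assms
    by (simp add: U_def take_upt drop_upt del: upt_Suc)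
  define V where "V = proj i j T"
  have V: "is_tableau V" "entries V = {i..n} - set [Suc j..<Suc n]"
    "set (snd V) \<inter> {..j} = set (snd U) \<inter> {..j}"
    unfolding V_def P U(2)[symmetric]
    using fold_jdt_remove_above[OF U(1), of "[Suc j..<Suc n]" j] by (simp_all del: upt_Suc)
  have "{i..n} - set [Suc j..<Suc n] = {i..j}" using assms by auto
  then have eV: "entries V = {i..j}" using V(2) by simp
  then have "set (snd V) \<subseteq> {..j}" by (auto simp: entries_def)
  then have sV: "set (snd V) = set (snd U) \<inter> {..j}" using V(3) by blast
  let ?R = "{(b, a) \<in> arcs (set (snd T)). i \<le> b \<and> a \<le> j}"
  have "set (snd U) = snd ` arcs (set (snd U))"
    using snd_arcs[OF tableau_height_nonneg[OF U(1,2)]] assms by simp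
  then have "set (snd V) = snd ` ?R" unfolding sV U(3) by force
  moreover have "?R \<subseteq> arcs (set (snd T))" by auto
  ultimately have "card (set (snd V)) = arc_count (set (snd T)) i j"
    unfolding arc_count_def by (simp add: card_image inj_on_snd_arcs)
  moreover have "distinct (snd V)" using V(1) by (simp add: is_tableau_def sorted_wrt_less_distinct)
  ultimately show "length (snd (proj i j T)) = arc_count (set (snd T)) i j"
    by (simp add: distinct_card V_def)
  show "is_tableau (proj i j T)" "entries (proj i j T) = {i..j}" using V(1) eV by (auto simp: V_def)
  show "set (snd (proj i j T)) = set (snd T) \<inter> {..j}" if "i = 1"
    using sV that by (simp add: V_def U_def)
qed

section \<open>Dominance of two-column shapes and the chain order\<close>

lemma tableau_boxes: "is_tableau T \<Longrightarrow> boxes T = card (entries T)"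
  unfolding is_tableau_def boxes_def entries_def
  by (metis card_Un_disjoint distinct_card finite_set sorted_wrt_less_distinct)

text \<open>The second partial sum, if compared at all, is the common number of boxes, so only the
  lengths of the first columns matter.\<close>

lemma dominated_by_shape:
  assumes "is_tableau S" "is_tableau T" "entries S = entries T" "entries S \<noteq> {}"
  shows "dominated_by (shape T) (shape S) \<longleftrightarrow> length (snd S) \<le> length (snd T)"
proof -
  have b: "length (fst S) + length (snd S) = length (fst T) + length (snd T)"
    using tableau_boxes[OF assms(1)] tableau_boxes[OF assms(2)] assms(3) by (simp add: boxes_def)
  have pos: "fst S \<noteq> []" "fst T \<noteq> []" using assms by (auto simp: is_tableau_def entries_def)
  have s: "shape V = (if snd V = [] then [length (fst V)] else [length (fst V), length (snd V)])"
    if "fst V \<noteq> []" for V using that by (simp add: shape_def)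
  have "dominated_by (shape T) (shape S) \<longleftrightarrow> length (fst T) \<le> length (fst S)"
  proof
    assume "dominated_by (shape T) (shape S)"
    then show "length (fst T) \<le> length (fst S)"
      unfolding dominated_by_def s[OF pos(1)] s[OF pos(2)]
      by (drule_tac spec[of _ 1]) (auto split: if_splits)
  next
    assume l: "length (fst T) \<le> length (fst S)"
    show "dominated_by (shape T) (shape S)"
      unfolding dominated_by_def s[OF pos(1)] s[OF pos(2)]
    proof (intro allI impI)
      fix i :: nat
      let ?s = "if snd S = [] then [length (fst S)] else [length (fst S), length (snd S)]"
      let ?t = "if snd T = [] then [length (fst T)] else [length (fst T), length (snd T)]"
      assume "1 \<le> i \<and> i \<le> min (length ?s) (length ?t)"
      then have "i = 1 \<or> i = 2 \<and> snd S \<noteq> [] \<and> snd T \<noteq> []" by (auto split: if_splits)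
      then show "sum_list (take i ?t) \<le> sum_list (take i ?s)" using l b by auto
    qed
  qed
  then show ?thesis using b by linarith
qed

lemma chain_le_iff_arcs:
  assumes S: "S \<in> std_tableaux n" and T: "T \<in> std_tableaux n"
  shows "chain_le n T S \<longleftrightarrow> arcs (set (snd S)) \<subseteq> arcs (set (snd T))"
proof -
  have S': "is_tableau S" "entries S = {1..n}" using S by (auto simp: std_tableaux_def)
  have "dominated_by (shape (proj i j T)) (shape (proj i j S)) \<longleftrightarrow>
      arc_count (set (snd S)) i j \<le> arc_count (set (snd T)) i j"
    if "1 \<le> i \<and> i < j \<and> j \<le> n" for i j
    using dominated_by_shape[of "proj i j S" "proj i j T"] proj_std[OF S, of i j] proj_std[OF T, of i j] that
    by simp
  then show ?thesis
    unfolding chain_le_def using arcs_subset_iff[OF tableau_arcs[OF S']] by simp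
qed

lemma std_tableau_arcs_inj:
  assumes S: "S \<in> std_tableaux n" and T: "T \<in> std_tableaux n"
    and "arcs (set (snd S)) = arcs (set (snd T))"
  shows "S = T"
proof -
  have S': "is_tableau S" "entries S = {1..n}" and T': "is_tableau T" "entries T = {1..n}"
    using S T by (auto simp: std_tableaux_def)
  have "set (snd S) = set (snd T)"
    using snd_arcs[OF tableau_height_nonneg[OF S']] snd_arcs[OF tableau_height_nonneg[OF T']] assms(3)
    by (metis le_add1 plus_1_eq_Suc)
  then show ?thesis using tableau_eqI[OF S'(1) T'(1)] S' T' by simp
qed

lemma chain_less_iff_arcs:
  assumes S: "S \<in> std_tableaux n" and T: "T \<in> std_tableaux n"
  shows "chain_less n T S \<longleftrightarrow> arcs (set (snd S)) \<subset> arcs (set (snd T))"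
  using chain_le_iff_arcs[OF S T] std_tableau_arcs_inj[OF S T] by (auto simp: chain_less_def)

section \<open>Covers\<close>

lemma move_left_std:
  assumes T: "T \<in> std_tableaux n" and x: "x \<in> set (snd T)"
  shows "move_left T x \<in> std_tableaux n" "set (snd (move_left T x)) = set (snd T) - {x}"
proof -
  have T': "sorted_wrt (<) (snd T)" "sorted_wrt (<) (fst T)" "set (fst T) \<inter> set (snd T) = {}"
    "0 \<notin> entries T" "entries T = {1..n}" "\<And>p. cnt (set (snd T)) p \<le> cnt (set (fst T)) p"
    using T by (auto simp: std_tableaux_def is_tableau_iff)
  have xF: "x \<notin> set (fst T)" using T'(3) x by auto
  show s: "set (snd (move_left T x)) = set (snd T) - {x}"
    using sorted_wrt_less_distinct[OF T'(1)] by (simp add: move_left_def)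
  have f: "set (fst (move_left T x)) = insert x (set (fst T))"
    by (simp add: move_left_def set_insort_key)
  have "cnt (set (snd T) - {x}) p \<le> cnt (insert x (set (fst T))) p" for p
    using T'(6)[of p] cnt_remove[OF _ x, of p] cnt_insert[OF _ xF, of p] by simp
  moreover have "sorted_wrt (<) (fst (move_left T x))" "sorted_wrt (<) (snd (move_left T x))"
    using T'(1,2) xF
    by (auto simp: move_left_def strict_sorted_iff sorted_remove1 sorted_insort distinct_insort)
  moreover have "entries (move_left T x) = {1..n}"
    using T'(5) x unfolding entries_def s f by auto
  ultimately show "move_left T x \<in> std_tableaux n"
    using T'(3,4,5) s f by (auto simp: std_tableaux_def is_tableau_iff)
qed

text \<open>Moving the closer of an outermost arc loses just that arc, so nothing fits strictly in
  between. Conversely, \<open>ex_outer_arc\<close> yields such a tableau above \<open>T\<close> and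
  at most \<open>S\<close>; if \<open>S\<close> is a cover, it is \<open>S\<close> itself.\<close>

lemma cover_eq_outer:
  assumes T: "T \<in> std_tableaux n"
  shows "cover n T = {move_left T x | x. x \<in> set (snd T) \<and> outer (set (snd T)) x}"
proof -
  have T': "is_tableau T" "entries T = {1..n}" using T by (auto simp: std_tableaux_def)
  note pos = tableau_height_nonneg[OF T']
  have arc: "arcs (set (snd (move_left T x))) = arcs (set (snd T)) - {(y, x)}"
    if "(y, x) \<in> arcs (set (snd T))" "outer (set (snd T)) x" for y x
    using arcs_remove[OF that] move_left_std[OF T arcs_mem(1)[OF that(1)]] by simp
  show ?thesis
  proof (intro equalityI subsetI)
    fix S assume "S \<in> cover n T"
    then have S: "S \<in> std_tableaux n" "chain_less n T S"
      "\<And>P. P \<in> std_tableaux n \<Longrightarrow> chain_less n T P \<Longrightarrow> \<not> chain_less n P S"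
      by (auto simp: cover_def)
    have S': "is_tableau S" "entries S = {1..n}" using S(1) by (auto simp: std_tableaux_def)
    have "arcs (set (snd S)) \<subset> arcs (set (snd T))" using S chain_less_iff_arcs[OF S(1) T] by simp
    then obtain y x where yx: "(y, x) \<in> arcs (set (snd T))" "outer (set (snd T)) x"
      "arcs (set (snd S)) \<subseteq> arcs (set (snd T)) - {(y, x)}"
      using ex_outer_arc[OF pos tableau_height_nonneg[OF S']] by auto
    have x: "x \<in> set (snd T)" using arcs_mem yx(1) by blast
    let ?P = "move_left T x"
    have P: "?P \<in> std_tableaux n" by (rule move_left_std[OF T x])
    have "chain_less n T ?P" using chain_less_iff_arcs[OF P T] arc[OF yx(1,2)] yx(1) by auto
    then have "\<not> chain_less n ?P S" using S(3)[OF P] by simp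
    then have "S = ?P"
      using chain_less_iff_arcs[OF S(1) P] std_tableau_arcs_inj[OF S(1) P] arc[OF yx(1,2)] yx(3) by auto
    then show "S \<in> {move_left T x | x. x \<in> set (snd T) \<and> outer (set (snd T)) x}"
      using x yx(2) by blast
  next
    fix S assume "S \<in> {move_left T x | x. x \<in> set (snd T) \<and> outer (set (snd T)) x}"
    then obtain x where x: "S = move_left T x" "x \<in> set (snd T)" "outer (set (snd T)) x" by blast
    then obtain y where y: "(y, x) \<in> arcs (set (snd T))"
      using snd_arcs[OF pos] by force
    have S: "S \<in> std_tableaux n" using move_left_std[OF T x(2)] x(1) by simp
    have aS: "arcs (set (snd S)) = arcs (set (snd T)) - {(y, x)}" using arc[OF y x(3)] x(1) by simp
    have "\<not> (chain_less n T P \<and> chain_less n P S)" if P: "P \<in> std_tableaux n" for P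
      using chain_less_iff_arcs[OF P T] chain_less_iff_arcs[OF S P] aS by auto
    moreover have "chain_less n T S" using chain_less_iff_arcs[OF S T] aS y by auto
    ultimately show "S \<in> cover n T" using S by (auto simp: cover_def)
  qed
qed

section \<open>The tableau \<open>T{x}\<close>\<close>

lemma cnt_mono: "finite A \<Longrightarrow> B \<subseteq> A \<Longrightarrow> p \<le> q \<Longrightarrow> cnt B p \<le> cnt A q"
  unfolding cnt_def by (rule card_mono) auto

lemma cnt_above: "A \<subseteq> {..n} \<Longrightarrow> n \<le> p \<Longrightarrow> cnt A p = cnt A n"
  unfolding cnt_def by (rule arg_cong[of _ _ card]) auto

lemma cnt_split:
  assumes "finite A" "x \<le> p"
  shows "cnt A p = cnt A x + cnt (A \<inter> {x<..}) p"
proof -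
  have "{y \<in> A. y \<le> p} = {y \<in> A. y \<le> x} \<union> {y \<in> A \<inter> {x<..}. y \<le> p}" using assms(2) by auto
  then show ?thesis unfolding cnt_def using assms(1) by (simp add: card_Un_disjoint disjoint_iff)
qed

text \<open>From \<open>M\<close> on, the count of \<open>B\<close> keeps its value at
  \<open>M - 1\<close>, where \<open>M\<close> is not yet counted in \<open>A\<close>.\<close>

lemma ballot_remove_max_opener:
  assumes "finite A" "M \<in> A" "B \<subseteq> {..<M}"
  shows "(\<forall>p. cnt B p \<le> cnt A p) \<longleftrightarrow> (\<forall>p. cnt B p \<le> cnt (A - {M}) p)"
proof (intro iffI allI)
  fix p
  have c: "cnt A q = cnt (A - {M}) q + (if M \<le> q then 1 else 0)" for q
    by (rule cnt_remove[OF assms(1,2)])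
  {
    assume b: "\<forall>p. cnt B p \<le> cnt A p"
    show "cnt B p \<le> cnt (A - {M}) p"
    proof (cases "M \<le> p")
      case True
      show ?thesis
      proof (cases M)
        case 0
        then have "B = {}" using assms(3) by auto
        then show ?thesis by (simp add: cnt_def)
      next
        case (Suc m)
        have "B \<subseteq> {..m}" using assms(3) Suc by auto
        then have "cnt B p = cnt B m" using cnt_above[of B m p] True Suc by simp
        also have "\<dots> \<le> cnt A m" using b by simp
        also have "\<dots> = cnt (A - {M}) m" using c[of m] Suc by simp
        also have "\<dots> \<le> cnt (A - {M}) p" using assms(1) True Suc by (intro cnt_mono) auto
        finally show ?thesis .
      qed
    next
      case False
      then show ?thesis using spec[OF b, of p] c[of p] by simp
    qed
  next
    assume "\<forall>p. cnt B p \<le> cnt (A - {M}) p"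
    then show "cnt B p \<le> cnt A p" using c[of p] by (simp add: trans_le_add1)
  }
qed

text \<open>\<open>b\<close> and \<open>M\<close> are removed as a matched pair. Before
  \<open>b\<close> neither removal is visible; from \<open>b\<close> on \<open>A - {b}\<close> has
  its full count, so it suffices to compare at \<open>M\<close>, where both counts drop by
  one.\<close>

lemma ballot_remove_max_closer:
  assumes "finite A" "finite B" "M \<in> B" "B \<subseteq> {..M}" "b \<in> A" "A \<subseteq> {..b}" "b < M"
  shows "(\<forall>p. cnt B p \<le> cnt A p) \<longleftrightarrow> (\<forall>p. cnt (B - {M}) p \<le> cnt (A - {b}) p)"
proof (intro iffI allI)
  fix p
  have cA: "cnt A q = cnt (A - {b}) q + (if b \<le> q then 1 else 0)" for q
    by (rule cnt_remove[OF assms(1,5)])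
  have cB: "cnt B q = cnt (B - {M}) q + (if M \<le> q then 1 else 0)" for q
    by (rule cnt_remove[OF assms(2,3)])
  {
    assume h: "\<forall>p. cnt B p \<le> cnt A p"
    show "cnt (B - {M}) p \<le> cnt (A - {b}) p"
    proof (cases "b \<le> p")
      case True
      have "cnt (B - {M}) p \<le> cnt (B - {M}) M"
      proof (cases "p \<le> M")
        case True
        then show ?thesis using assms(2) by (intro cnt_mono) auto
      next
        case False
        then have "cnt (B - {M}) p = cnt (B - {M}) M" using assms(4) by (intro cnt_above) auto
        then show ?thesis by simp
      qed
      also have "\<dots> \<le> cnt (A - {b}) M" using spec[OF h, of M] cA[of M] cB[of M] assms(7) by simp
      also have "\<dots> = cnt (A - {b}) b" using assms(6,7) by (intro cnt_above) auto
      also have "\<dots> \<le> cnt (A - {b}) p" using assms(1) True by (intro cnt_mono) auto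
      finally show ?thesis .
    next
      case False
      then show ?thesis using spec[OF h, of p] cA[of p] cB[of p] assms(7) by simp
    qed
  next
    assume "\<forall>p. cnt (B - {M}) p \<le> cnt (A - {b}) p"
    from spec[OF this, of p] show "cnt B p \<le> cnt A p" using cA[of p] cB[of p] assms(7) by simp
  }
qed

section \<open>The deletion sequence\<close>

definition delete_max :: "tableau \<Rightarrow> tableau" where
  "delete_max U = delete_corner U (Max (entries U))"

lemma finite_entries: "finite (entries U)"
  by (simp add: entries_def)

lemma delete_max_first:
  assumes U: "is_tableau U" and M: "Max (entries U) \<in> set (fst U)"
  shows "is_tableau (delete_max U)" "set (fst (delete_max U)) = set (fst U) - {Max (entries U)}"
    "snd (delete_max U) = snd U"
proof -
  let ?M = "Max (entries U)"
  have UU: "sorted_wrt (<) (snd U)" "sorted_wrt (<) (fst U)" "set (fst U) \<inter> set (snd U) = {}"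
    "0 \<notin> entries U" "\<forall>p. cnt (set (snd U)) p \<le> cnt (set (fst U)) p"
    using U by (auto simp: is_tableau_iff)
  have D: "delete_max U = (remove1 ?M (fst U), snd U)" using M by (simp add: delete_max_def delete_corner_def)
  have s: "set (remove1 ?M (fst U)) = set (fst U) - {?M}"
    using sorted_wrt_less_distinct[OF UU(2)] by simp
  have "set (snd U) \<subseteq> {..<?M}"
  proof
    fix y assume y: "y \<in> set (snd U)"
    then have "y \<le> ?M" by (intro Max_ge) (auto simp: entries_def)
    moreover have "y \<noteq> ?M" using y M UU(3) by auto
    ultimately show "y \<in> {..<?M}" by simp
  qed
  then have "\<forall>p. cnt (set (snd U)) p \<le> cnt (set (fst U) - {?M}) p"
    using ballot_remove_max_opener[OF _ M] UU(5) by blast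
  moreover have "sorted_wrt (<) (remove1 ?M (fst U))"
    using UU(2) by (simp add: strict_sorted_iff sorted_remove1)
  ultimately show "is_tableau (delete_max U)"
    using UU s unfolding D is_tableau_iff by (auto simp: entries_def)
  show "set (fst (delete_max U)) = set (fst U) - {?M}" "snd (delete_max U) = snd U"
    using D s by auto
qed

text \<open>The maximum exceeds the whole first column, so it replaces the greatest entry
  \<open>b\<close> there and the column stays increasing.\<close>

lemma delete_max_second:
  assumes U: "is_tableau U" and M: "Max (entries U) \<in> set (snd U)"
  defines "b \<equiv> Max (set (fst U))"
  shows "is_tableau (delete_max U)"
    "set (fst (delete_max U)) = insert (Max (entries U)) (set (fst U) - {b})"
    "set (snd (delete_max U)) = set (snd U) - {Max (entries U)}"
    "b \<in> set (fst U)" "b < Max (entries U)"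
    "\<forall>p. cnt (set (snd U) - {Max (entries U)}) p \<le> cnt (set (fst U) - {b}) p"
proof -
  let ?M = "Max (entries U)"
  have UU: "sorted_wrt (<) (snd U)" "sorted_wrt (<) (fst U)" "set (fst U) \<inter> set (snd U) = {}"
    "0 \<notin> entries U" "\<forall>p. cnt (set (snd U)) p \<le> cnt (set (fst U)) p"
    using U by (auto simp: is_tableau_iff)
  have MF: "?M \<notin> set (fst U)" using M UU(3) by auto
  have le: "y \<le> ?M" if "y \<in> entries U" for y using Max_ge[OF finite_entries that] .
  have "set (fst U) \<noteq> {}" using U M by (auto simp: is_tableau_def)
  then show b: "b \<in> set (fst U)" unfolding b_def by (intro Max_in) auto
  have lt: "y < ?M" if "y \<in> set (fst U)" for y
  proof -
    have "y \<le> ?M" using le[of y] that by (simp add: entries_def)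
    moreover have "y \<noteq> ?M" using that MF by auto
    ultimately show ?thesis by simp
  qed
  show bM: "b < ?M" using lt[OF b] .
  have leb: "y \<le> b" if "y \<in> set (fst U)" for y unfolding b_def using that by simp
  have "{y \<in> set (fst U). y < ?M} = set (fst U)" using lt by auto
  then have D: "delete_max U = (map (\<lambda>y. if y = b then ?M else y) (fst U), remove1 ?M (snd U))"
    using MF by (simp add: delete_max_def delete_corner_def b_def)
  have s: "set (remove1 ?M (snd U)) = set (snd U) - {?M}"
    using sorted_wrt_less_distinct[OF UU(1)] by simp
  have f: "set (map (\<lambda>y. if y = b then ?M else y) (fst U)) = insert ?M (set (fst U) - {b})"
    using b by auto
  show rm: "\<forall>p. cnt (set (snd U) - {?M}) p \<le> cnt (set (fst U) - {b}) p"
  proof (rule iffD1[OF ballot_remove_max_closer])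
    show "set (snd U) \<subseteq> {..?M}" using le by (auto simp: entries_def)
    show "set (fst U) \<subseteq> {..b}" using leb by auto
  qed (use UU b bM M in auto)
  have "\<forall>p. cnt (set (snd U) - {?M}) p \<le> cnt (insert ?M (set (fst U) - {b})) p"
    using rm cnt_mono[of "insert ?M (set (fst U) - {b})" "set (fst U) - {b}"]
    by (meson List.finite_set finite.insertI finite_Diff le_refl le_trans subset_insertI)
  moreover have "sorted_wrt (<) (map (\<lambda>y. if y = b then ?M else y) (fst U))"
    unfolding sorted_wrt_map
  proof (rule sorted_wrt_mono_rel[OF _ UU(2)])
    show "(if y = b then ?M else y) < (if z = b then ?M else z)"
      if "y \<in> set (fst U)" "z \<in> set (fst U)" "y < z" for y z
      using that leb[of z] lt[of y] by auto
  qed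
  moreover have "sorted_wrt (<) (remove1 ?M (snd U))"
    using UU(1) by (simp add: strict_sorted_iff sorted_remove1)
  moreover have pos: "0 < ?M" using bM by simp
  moreover have "insert ?M (set (fst U) - {b}) \<inter> (set (snd U) - {?M}) = {}"
    using UU(3) by blast
  moreover have "0 \<notin> set (fst U)" "0 \<notin> set (snd U)" using UU(4) by (simp_all add: entries_def)
  moreover from this have "0 \<notin> insert ?M (set (fst U) - {b}) \<union> (set (snd U) - {?M})" using pos by simp
  ultimately show "is_tableau (delete_max U)"
    unfolding D is_tableau_iff entries_def[of "(_, _)"] fst_conv snd_conv f s by blast
  show "set (fst (delete_max U)) = insert ?M (set (fst U) - {b})"
    "set (snd (delete_max U)) = set (snd U) - {?M}"
    unfolding D using f s by auto
qed

text \<open>The maximum only changes columns. This is the coincidence of successive maxima by which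
  \<open>T{x}\<close> is defined.\<close>

lemma Max_delete_max_second:
  assumes U: "is_tableau U" and M: "Max (entries U) \<in> set (snd U)"
  shows "Max (entries (delete_max U)) = Max (entries U)"
proof (rule Max_eqI[OF finite_entries])
  note D = delete_max_second[OF assms]
  have eq: "entries V = set (fst V) \<union> set (snd V)" for V by (simp add: entries_def)
  show "Max (entries U) \<in> entries (delete_max U)" unfolding eq[of "delete_max U"] D(2) by simp
  fix y assume "y \<in> entries (delete_max U)"
  then have "y \<in> entries U" unfolding eq[of "delete_max U"] D(2,3) using M eq[of U] by blast
  then show "y \<le> Max (entries U)" by (rule Max_ge[OF finite_entries])
qed

lemma Max_entries_cases:
  assumes "entries U \<noteq> {}"
  obtains (first) "Max (entries U) \<in> set (fst U)" | (second) "Max (entries U) \<in> set (snd U)"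
  using Max_in[OF finite_entries assms] by (auto simp: entries_def)

lemma boxes_eq_0_iff: "boxes U = 0 \<longleftrightarrow> entries U = {}"
  by (simp add: boxes_def entries_def)

lemma delete_max_tableau:
  assumes U: "is_tableau U" and ne: "entries U \<noteq> {}"
  shows "is_tableau (delete_max U)" "boxes (delete_max U) = boxes U - 1"
    "set (snd (delete_max U)) = set (snd U) - {Max (entries U)}"
proof -
  have disj: "set (fst U) \<inter> set (snd U) = {}" using U by (simp add: is_tableau_def)
  have "is_tableau (delete_max U) \<and> (\<exists>y \<in> entries U. entries (delete_max U) = entries U - {y}) \<and>
    set (snd (delete_max U)) = set (snd U) - {Max (entries U)}"
    using ne
  proof (cases rule: Max_entries_cases)
    case first
    have "entries (delete_max U) = entries U - {Max (entries U)}"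
      using delete_max_first[OF U first] first disj by (auto simp: entries_def)
    moreover have "Max (entries U) \<notin> set (snd U)" using first disj by auto
    ultimately show ?thesis using delete_max_first[OF U first] Max_in[OF finite_entries ne] by auto
  next
    case second
    note D = delete_max_second[OF U second]
    have "entries (delete_max U) = entries U - {Max (set (fst U))}"
    proof -
      have eq: "entries V = set (fst V) \<union> set (snd V)" for V by (simp add: entries_def)
      have "Max (set (fst U)) \<notin> set (snd U)" "Max (set (fst U)) \<noteq> Max (entries U)"
        using D(4,5) disj by auto
      then show ?thesis unfolding eq[of "delete_max U"] D(2,3)
        using second eq[of U] by blast
    qed
    then show ?thesis using D by (auto simp: entries_def)
  qed
  then obtain y where D: "is_tableau (delete_max U)" "y \<in> entries U"
    "entries (delete_max U) = entries U - {y}"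
    "set (snd (delete_max U)) = set (snd U) - {Max (entries U)}" by blast
  then show "is_tableau (delete_max U)" "set (snd (delete_max U)) = set (snd U) - {Max (entries U)}"
    by simp_all
  show "boxes (delete_max U) = boxes U - 1"
    using tableau_boxes[OF U] tableau_boxes[OF D(1)] D(2,3) by simp
qed

lemma stage_boxes: "stage U (boxes U) = U"
  by (simp add: stage_def)

text \<open>Stages are numbered by the boxes left, so those of \<open>delete_max U\<close> are the
  later stages of \<open>U\<close>.\<close>

lemma stage_delete_max:
  assumes "is_tableau U" "i < boxes U"
  shows "stage (delete_max U) i = stage U i"
proof -
  have "entries U \<noteq> {}" using assms(2) boxes_eq_0_iff[of U] by auto
  then have b: "boxes (delete_max U) = boxes U - 1" using delete_max_tableau assms(1) by blast
  have "boxes U - i = Suc (boxes (delete_max U) - i)" using assms(2) b by simp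
  then show ?thesis unfolding stage_def delete_max_def[symmetric] by (simp add: funpow_swap1)
qed

definition hits :: "tableau \<Rightarrow> nat \<Rightarrow> nat \<Rightarrow> bool" where
  "hits U x i \<longleftrightarrow> 1 < i \<and> i \<le> boxes U \<and> stage_max U i = x \<and> stage_max U (i - 1) = x"

lemma brace_hits: "brace U x = stage U (THE i. hits U x i)"
  by (simp add: brace_def hits_def)

text \<open>Peels off the first deletion: the index \<open>boxes U\<close> is a hit iff the maximum
  survives that deletion, that is, iff it lies in the second column.\<close>

lemma hits_iff:
  assumes U: "is_tableau U" and ne: "entries U \<noteq> {}"
  shows "hits U x i \<longleftrightarrow>
    (i = boxes U \<and> x = Max (entries U) \<and> x \<in> set (snd U)) \<or> hits (delete_max U) x i"
proof -
  have bd: "boxes (delete_max U) = boxes U - 1" by (rule delete_max_tableau[OF U ne])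
  have bpos: "0 < boxes U" using ne boxes_eq_0_iff[of U] by auto
  show ?thesis
  proof (cases "i = boxes U \<and> 1 < i")
    case False
    then consider "i \<le> 1" | "i < boxes U" | "boxes U < i" by linarith
    then show ?thesis
    proof cases
      case 1
      have "x \<notin> set (snd U)" if "i = boxes U"
      proof -
        have "length (snd U) = 0" using U 1 that unfolding boxes_def is_tableau_def by linarith
        then show ?thesis by simp
      qed
      then show ?thesis using 1 by (auto simp: hits_def)
    next
      case 2
      then show ?thesis
        using stage_delete_max[OF U, of i] stage_delete_max[OF U, of "i - 1"] bd
        by (auto simp: hits_def stage_max_def)
    next
      case 3
      then show ?thesis using bd by (auto simp: hits_def)
    qed
  next
    case True
    let ?M = "Max (entries U)" and ?D = "delete_max U"
    have "stage U (i - 1) = ?D"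
      using stage_delete_max[OF U, of "i - 1"] stage_boxes[of ?D] bd True by simp
    then have h: "hits U x i \<longleftrightarrow> ?M = x \<and> Max (entries ?D) = x"
      using True stage_boxes[of U] by (auto simp: hits_def stage_max_def)
    have "\<not> hits ?D x i" using True bd by (auto simp: hits_def)
    moreover have "Max (entries ?D) = ?M \<longleftrightarrow> ?M \<in> set (snd U)"
      using ne
    proof (cases rule: Max_entries_cases)
      case first
      have M: "?M \<notin> set (snd U)" using first U by (auto simp: is_tableau_def)
      have "entries ?D = entries U - {?M}"
        using delete_max_first[OF U first] M by (auto simp: entries_def)
      moreover have "entries ?D \<noteq> {}" using bd True boxes_eq_0_iff[of ?D] by auto
      ultimately have "Max (entries ?D) \<noteq> ?M" using Max_in[OF finite_entries, of ?D] by auto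
      then show ?thesis using M by simp
    next
      case second
      then show ?thesis using Max_delete_max_second[OF U] by simp
    qed
    ultimately show ?thesis using h True by auto
  qed
qed

lemma hits_mem: "is_tableau U \<Longrightarrow> hits U x i \<Longrightarrow> x \<in> set (snd U)"
proof (induction "boxes U" arbitrary: U)
  case 0
  then show ?case by (auto simp: hits_def)
next
  case (Suc k)
  have ne: "entries U \<noteq> {}" using Suc.hyps(2) boxes_eq_0_iff[of U] by auto
  note D = delete_max_tableau[OF Suc.prems(1) ne]
  have k: "k = boxes (delete_max U)" using D(2) Suc.hyps(2) by simp
  consider "x \<in> set (snd U)" | "hits (delete_max U) x i"
    using hits_iff[OF Suc.prems(1) ne] Suc.prems(2) by blast
  then show ?case using Suc.hyps(1)[OF k D(1)] D(3) by cases auto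
qed

text \<open>An entry leaves the second column once, at the stage where it is the maximum; afterwards
  \<open>hits_mem\<close> excludes further hits.\<close>

lemma ex1_hits: "is_tableau U \<Longrightarrow> x \<in> set (snd U) \<Longrightarrow> \<exists>!i. hits U x i"
proof (induction "boxes U" arbitrary: U)
  case 0
  then show ?case by (simp add: boxes_def)
next
  case (Suc k)
  have ne: "entries U \<noteq> {}" using Suc.hyps(2) boxes_eq_0_iff[of U] by auto
  note D = delete_max_tableau[OF Suc.prems(1) ne]
  show ?case
  proof (cases "x = Max (entries U)")
    case True
    then have "\<not> hits (delete_max U) x i" for i using hits_mem[OF D(1), of x i] D(3) by auto
    then have "hits U x = (\<lambda>i. i = boxes U)" using True Suc.prems(2) hits_iff[OF Suc.prems(1) ne] by blast
    then show ?thesis by simp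
  next
    case False
    have k: "k = boxes (delete_max U)" using D(2) Suc.hyps(2) by simp
    have "hits U x = hits (delete_max U) x" using False hits_iff[OF Suc.prems(1) ne] by blast
    then show ?thesis using Suc.hyps(1)[OF k D(1)] Suc.prems(2) False D(3) by simp
  qed
qed

lemma brace_Max:
  assumes U: "is_tableau U" and x: "x \<in> set (snd U)" and M: "x = Max (entries U)"
  shows "brace U x = U"
proof -
  have "entries U \<noteq> {}" using x by (auto simp: entries_def)
  then have "hits U x (boxes U)" using hits_iff[OF U, of x "boxes U"] x M by simp
  then have "(THE i. hits U x i) = boxes U" using ex1_hits[OF U x] by (simp add: the1_equality)
  then show ?thesis by (simp add: brace_hits stage_boxes)
qed

text \<open>With \<open>brace_Max\<close> as base case this describes \<open>brace\<close> by
  recursion over deletions and avoids the definite description.\<close>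

lemma brace_delete_max:
  assumes U: "is_tableau U" and x: "x \<in> set (snd U)" and M: "x \<noteq> Max (entries U)"
  shows "brace (delete_max U) x = brace U x"
proof -
  have ne: "entries U \<noteq> {}" using x by (auto simp: entries_def)
  note D = delete_max_tableau[OF U ne]
  have h: "hits U x = hits (delete_max U) x" using hits_iff[OF U ne] M by auto
  have "i < boxes U" if "hits (delete_max U) x i" for i using that D(2) by (auto simp: hits_def)
  moreover have "hits (delete_max U) x (THE i. hits (delete_max U) x i)"
    using theI'[OF ex1_hits[OF D(1), of x]] D(3) x M by auto
  ultimately have "(THE i. hits (delete_max U) x i) < boxes U" by blast
  then show ?thesis using stage_delete_max[OF U] h by (simp add: brace_hits)
qed

text \<open>
  A deleted entry \<open>M\<close> of the second column disappears in the next step together with the greatest entry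
  \<open>b\<close> of the first column. So the first column of \<open>T{x}\<close> is a full restriction iff the entries
  greater than \<open>x\<close> of the second column can be matched within those of the first.
\<close>

lemma brace_columns:
  assumes "is_tableau U" "x \<in> set (snd U)"
  shows "is_tableau (brace U x) \<and> set (fst (brace U x)) \<subseteq> set (fst U) \<and>
    set (snd (brace U x)) = {y \<in> set (snd U). y \<le> x} \<and>
    (set (fst (brace U x)) = {y \<in> set (fst U). y < x} \<longleftrightarrow>
      (\<forall>p. cnt (set (snd U) \<inter> {x<..}) p \<le> cnt (set (fst U) \<inter> {x<..}) p))"
  using assms
proof (induction "boxes U" arbitrary: U rule: less_induct)
  case less
  note U = less.prems(1) and x = less.prems(2)
  let ?M = "Max (entries U)" and ?D = "delete_max U"
  have ne: "entries U \<noteq> {}" using x by (auto simp: entries_def)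
  have disj: "set (fst U) \<inter> set (snd U) = {}" using U by (simp add: is_tableau_def)
  have le: "y \<le> ?M" if "y \<in> entries U" for y using Max_ge[OF finite_entries that] .
  have bpos: "0 < boxes U" using ne boxes_eq_0_iff[of U] by auto
  note DT = delete_max_tableau[OF U ne]
  show ?case
  proof (cases "x = ?M")
    case True
    \<comment> \<open>With \<open>x\<close> maximal, nothing lies above it and \<open>brace\<close>
      returns \<open>U\<close>: both sides of the equivalence hold.\<close>
    have s: "{y \<in> set (snd U). y \<le> x} = set (snd U)" using le True by (auto simp: entries_def)
    have f: "{y \<in> set (fst U). y < x} = set (fst U)"
      using le True disj x by (fastforce simp: entries_def order.strict_iff_order)
    have "set (snd U) \<subseteq> {..x}" using s by blast
    moreover have "{..x} \<inter> {x<..} = {}" by auto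
    ultimately have "set (snd U) \<inter> {x<..} = {}" by blast
    then show ?thesis using brace_Max[OF U x True] U s f by (simp add: cnt_def)
  next
    case xM: False
    have "x \<in> entries U" using x by (simp add: entries_def)
    from le[OF this] have xltM: "x < ?M" using xM by simp
    have xD: "x \<in> set (snd ?D)" using DT(3) x xM by simp
    have br: "brace U x = brace ?D x" using brace_delete_max[OF U x xM] by simp
    show ?thesis
      using ne
    proof (cases rule: Max_entries_cases)
      case first
      note D = delete_max_first[OF U first]
      have IH: "is_tableau (brace ?D x) \<and> set (fst (brace ?D x)) \<subseteq> set (fst ?D) \<and>
        set (snd (brace ?D x)) = {y \<in> set (snd ?D). y \<le> x} \<and>
        (set (fst (brace ?D x)) = {y \<in> set (fst ?D). y < x} \<longleftrightarrow>
          (\<forall>p. cnt (set (snd ?D) \<inter> {x<..}) p \<le> cnt (set (fst ?D) \<inter> {x<..}) p))"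
        using less.hyps[of ?D] DT(1,2) bpos xD by simp
      have f: "{y \<in> set (fst ?D). y < x} = {y \<in> set (fst U). y < x}"
        unfolding D(2) using xltM by force
      have "set (snd U) \<inter> {x<..} \<subseteq> {..<?M}"
        using le first disj by (fastforce simp: entries_def order.strict_iff_order)
      then have "(\<forall>p. cnt (set (snd U) \<inter> {x<..}) p \<le> cnt (set (fst U) \<inter> {x<..}) p) \<longleftrightarrow>
        (\<forall>p. cnt (set (snd U) \<inter> {x<..}) p \<le> cnt (set (fst U) \<inter> {x<..} - {?M}) p)"
        using first xltM by (intro ballot_remove_max_opener) auto
      moreover have "set (fst U) \<inter> {x<..} - {?M} = set (fst ?D) \<inter> {x<..}"
        unfolding D(2) by blast
      ultimately show ?thesis using IH br f D(2,3) by auto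
    next
      case second
      note D = delete_max_second[OF U second]
      define b where "b = Max (set (fst U))"
      \<comment> \<open>\<open>M\<close> is still the maximum after moving to the first column, so
        two deletions together remove the pair \<open>M\<close> and \<open>b\<close>.\<close>
      let ?E = "delete_max ?D"
      note maxD = Max_delete_max_second[OF U second]
      have firstD: "Max (entries ?D) \<in> set (fst ?D)" using maxD D(2) by simp
      note E = delete_max_first[OF D(1) firstD, unfolded maxD]
      have MF: "?M \<notin> set (fst U)" using second disj by auto
      have fE: "set (fst ?E) = set (fst U) - {b}" using E(2) D(2) MF by (auto simp: b_def)
      have sE: "set (snd ?E) = set (snd U) - {?M}" using E(3) D(3) by simp
      have brE: "brace U x = brace ?E x" using br brace_delete_max[OF D(1) xD] maxD xM by simp
      have neD: "entries ?D \<noteq> {}" using xD by (auto simp: entries_def)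
      have bE: "boxes ?E < boxes U" using DT(2) delete_max_tableau(2)[OF D(1) neD] bpos by simp
      have IH: "is_tableau (brace ?E x) \<and> set (fst (brace ?E x)) \<subseteq> set (fst ?E) \<and>
        set (snd (brace ?E x)) = {y \<in> set (snd ?E). y \<le> x} \<and>
        (set (fst (brace ?E x)) = {y \<in> set (fst ?E). y < x} \<longleftrightarrow>
          (\<forall>p. cnt (set (snd ?E) \<inter> {x<..}) p \<le> cnt (set (fst ?E) \<inter> {x<..}) p))"
        using less.hyps[OF bE E(1)] sE x xM by simp
      have s: "{y \<in> set (snd ?E). y \<le> x} = {y \<in> set (snd U). y \<le> x}"
        unfolding sE using xltM by force
      have b: "b \<in> set (fst U)" "b < ?M" using D(4,5) by (auto simp: b_def)
      have leb: "y \<le> b" if "y \<in> set (fst U)" for y unfolding b_def using that by simp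
      have iff: "set (fst (brace ?E x)) = {y \<in> set (fst U). y < x} \<longleftrightarrow>
        (\<forall>p. cnt (set (snd U) \<inter> {x<..}) p \<le> cnt (set (fst U) \<inter> {x<..}) p)"
      proof (cases "b < x")
        case True
        \<comment> \<open>Both sides fail: no first-column entry above \<open>x\<close> is left to
          match \<open>M\<close>, and \<open>b\<close>, which belongs to the restriction, is
          lost.\<close>
        have "set (fst U) \<inter> {x<..} = {}" using leb True by fastforce
        then have "cnt (set (fst U) \<inter> {x<..}) ?M = 0" by (simp add: cnt_def)
        moreover have "?M \<in> {y \<in> set (snd U) \<inter> {x<..}. y \<le> ?M}" using second xltM by simp
        then have "0 < cnt (set (snd U) \<inter> {x<..}) ?M" unfolding cnt_def by (subst card_gt_0_iff) auto
        ultimately have "\<not> (\<forall>p. cnt (set (snd U) \<inter> {x<..}) p \<le> cnt (set (fst U) \<inter> {x<..}) p)"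
          by (metis not_le)
        moreover have "b \<notin> set (fst (brace ?E x))" using IH fE by auto
        then have "set (fst (brace ?E x)) \<noteq> {y \<in> set (fst U). y < x}" using True b(1) by blast
        ultimately show ?thesis by blast
      next
        case False
        have "b \<noteq> x" using b(1) x disj by auto
        then have xb: "x < b" using False by simp
        \<comment> \<open>Both \<open>M\<close> and \<open>b\<close> exceed \<open>x\<close>, so the
          restriction is unaffected and the pair cancels in the ballot condition.\<close>
        have f: "{y \<in> set (fst ?E). y < x} = {y \<in> set (fst U). y < x}"
          unfolding fE using xb by auto
        have "(\<forall>p. cnt (set (snd U) \<inter> {x<..}) p \<le> cnt (set (fst U) \<inter> {x<..}) p) \<longleftrightarrow>
          (\<forall>p. cnt (set (snd U) \<inter> {x<..} - {?M}) p \<le> cnt (set (fst U) \<inter> {x<..} - {b}) p)"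
        proof (rule ballot_remove_max_closer)
          show "set (snd U) \<inter> {x<..} \<subseteq> {..?M}" using le by (auto simp: entries_def)
          show "set (fst U) \<inter> {x<..} \<subseteq> {..b}" using leb by auto
        qed (use second xltM xb b in auto)
        moreover have "set (snd U) \<inter> {x<..} - {?M} = set (snd ?E) \<inter> {x<..}"
          "set (fst U) \<inter> {x<..} - {b} = set (fst ?E) \<inter> {x<..}" unfolding fE sE by blast+
        ultimately show ?thesis using IH f by simp
      qed
      have "set (fst (brace U x)) \<subseteq> set (fst U)" using IH fE brE by auto
      then show ?thesis using IH iff s brE by simp
    qed
  qed
qed

text \<open>After \<open>x\<close> and up to \<open>n\<close>, the level changes by the surplus of
  first-column over second-column entries greater than \<open>x\<close>.\<close>

lemma outer_iff_cnt:
  assumes U: "is_tableau U" "entries U = {1..n}" and x: "x \<in> set (snd U)"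
  shows "outer (set (snd U)) x \<longleftrightarrow>
    (\<forall>p. cnt (set (snd U) \<inter> {x<..}) p \<le> cnt (set (fst U) \<inter> {x<..}) p)"
proof -
  let ?A = "set (fst U)" and ?B = "set (snd U)"
  have AB: "?A \<union> ?B = {1..n}" using U(2) by (simp add: entries_def)
  have xn: "1 \<le> x" "x \<le> n" using x AB by auto
  have h: "height ?B (Suc p) = height ?B (Suc x) + int (cnt (?A \<inter> {x<..}) p) - int (cnt (?B \<inter> {x<..}) p) + int (p - n)"
    if "x \<le> p" for p
    using tableau_height[OF U, of p] tableau_height[OF U, of x] cnt_split[OF _ that, of ?A]
      cnt_split[OF _ that, of ?B] xn that by simp
  show ?thesis
  proof (intro iffI allI)
    fix p assume o: "outer ?B x"
    have ok: "cnt (?B \<inter> {x<..}) p \<le> cnt (?A \<inter> {x<..}) p" if "x \<le> p" "p \<le> n" for p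
      using h[OF that(1)] that spec[OF o[unfolded outer_def], of "Suc p"] by simp
    consider "p < x" | "x \<le> p" "p \<le> n" | "n < p" by linarith
    then show "cnt (?B \<inter> {x<..}) p \<le> cnt (?A \<inter> {x<..}) p"
    proof cases
      case 1
      then have none: "{y \<in> ?B \<inter> {x<..}. y \<le> p} = {}" by auto
      show ?thesis unfolding cnt_def none by simp
    next
      case 3
      \<comment> \<open>Beyond \<open>n\<close> the path gains up steps that are no entries, so the
        comparison is made at \<open>n\<close>, where the counts have become constant.\<close>
      have "?A \<inter> {x<..} \<subseteq> {..n}" "?B \<inter> {x<..} \<subseteq> {..n}" using AB by auto
      then show ?thesis using 3 ok[of n] xn by (simp add: cnt_above[of _ n p])
    qed (rule ok)
  next
    assume c: "\<forall>p. cnt (?B \<inter> {x<..}) p \<le> cnt (?A \<inter> {x<..}) p"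
    show "outer ?B x"
      unfolding outer_def
    proof (intro allI impI)
      fix p assume "x < p"
      then obtain q where "p = Suc q" "x \<le> q" by (cases p) auto
      then show "height ?B (Suc x) \<le> height ?B p" using h[of q] spec[OF c, of q] by simp
    qed
  qed
qed

text \<open>Both second columns consist of the entries of \<open>snd T\<close> up to
  \<open>x\<close>, so the first columns decide, and \<open>brace_columns\<close> applies.\<close>

lemma proj_eq_brace_iff_outer:
  assumes T: "T \<in> std_tableaux n" and x: "x \<in> set (snd T)"
  shows "proj 1 x T = brace T x \<longleftrightarrow> outer (set (snd T)) x"
proof -
  have T': "is_tableau T" "entries T = {1..n}" using T by (auto simp: std_tableaux_def)
  have disj: "set (fst T) \<inter> set (snd T) = {}" using T'(1) by (simp add: is_tableau_def)
  have un: "set (fst T) \<union> set (snd T) = {1..n}" using T'(2) by (simp add: entries_def)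
  have xn: "1 \<le> x" "x \<le> n" using un x by auto
  let ?P = "proj 1 x T"
  have P: "is_tableau ?P" "entries ?P = {1..x}" "set (snd ?P) = set (snd T) \<inter> {..x}"
    using proj_std[OF T, of 1 x] xn by auto
  note V = brace_columns[OF T'(1) x]
  have "set (fst ?P) = {1..x} - set (snd ?P)" using P(1,2) by (auto simp: is_tableau_def entries_def)
  also have "\<dots> = {y \<in> {1..n} - set (snd T). y < x}" unfolding P(3) using x xn by (auto simp: le_less)
  also have "\<dots> = {y \<in> set (fst T). y < x}" using un[symmetric] disj by auto
  finally have f: "set (fst ?P) = {y \<in> set (fst T). y < x}" .
  have s: "set (snd ?P) = set (snd (brace T x))" using P(3) V by auto
  have "?P = brace T x \<longleftrightarrow> set (fst (brace T x)) = {y \<in> set (fst T). y < x}"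
  proof
    assume "set (fst (brace T x)) = {y \<in> set (fst T). y < x}"
    then show "?P = brace T x" using tableau_eqI[OF P(1)] V f s by (simp add: entries_def)
  qed (use f in simp)
  then show ?thesis using V outer_iff_cnt[OF T' x] by simp
qed

theorem proposition3p16:
  fixes n s :: nat and T :: tableau and a k :: "nat \<Rightarrow> nat"
  assumes "T \<in> std_tableaux n"
    and "set (snd T) = (\<Union>j\<in>{1..s}. {a j..a j + k j})"
    and "\<And>i. 1 < i \<Longrightarrow> i \<le> s \<Longrightarrow> a i > a (i - 1) + k (i - 1) + 1"
  shows "cover n T =
    {move_left T (a j + k j) | j.
       1 \<le> j \<and> j \<le> s \<and> proj 1 (a j + k j) T = brace T (a j + k j)}"
proof -
  have mem: "a j + k j \<in> set (snd T)" if "1 \<le> j" "j \<le> s" for j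
    unfolding assms(2) using that by force
  \<comment> \<open>After an outer \<open>x\<close> the path cannot go down at once, so
    \<open>x + 1\<close> is not in the second column.\<close>
  have run_end: "\<exists>j. 1 \<le> j \<and> j \<le> s \<and> x = a j + k j"
    if x: "x \<in> set (snd T)" and out: "outer (set (snd T)) x" for x
  proof -
    obtain j where j: "1 \<le> j" "j \<le> s" "a j \<le> x" "x \<le> a j + k j" using x unfolding assms(2) by auto
    have "height (set (snd T)) (Suc x) \<le> height (set (snd T)) (Suc (Suc x))"
      using out by (simp add: outer_def)
    then have "Suc x \<notin> set (snd T)" by (auto simp: height_Suc[of _ "Suc x"])
    then have "Suc x \<notin> {a j..a j + k j}" unfolding assms(2) using j by auto
    then have "x = a j + k j" using j by auto
    then show ?thesis using j by blast
  qed
  show ?thesis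
    unfolding cover_eq_outer[OF assms(1)]
    using mem run_end proj_eq_brace_iff_outer[OF assms(1)] by blast
qed

end
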